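(* Let $i\in\mathbb{Z}$ and let $k\ge1$ be an integer with $0\le i\le k$. Let $A^{-1}$ be the $(k+1)\times(k+1)$ matrix given in the context. For $\boldsymbol{n}=(n_1,\dots,n_{k+1})$ put $$\lambda_i(\boldsymbol{n}):=-\frac12\sum_{j=1}^{\min(k-i,\,k-1)}n_j+\sum_{j=k-i+1}^{k-1}\frac{2(j-k+i)-1}{2}\,n_j+\frac{2i-1}{4}(n_k+n_{k+1}).$$ Then $$q^{-\frac{(2i-1)^2}{8(2k+1)}}\,\frac{(-q)_\infty}{(q)_\infty}\sum_{n\in\mathbb{Z}}(2n+1)\,q^{\frac{2k+1}{2}\left(n+\frac{2i-1}{4k+2}\right)^2}(1+q^n)$$ $$=\sum_{\substack{n_1,n_2,\dots,n_{k+1}\ge0\\ n_k\equiv n_{k+1}\ (\mathrm{mod}\ 2)}}q^{\frac12\,\boldsymbol{n}\cdot A^{-1}\cdot\boldsymbol{n}^T+\lambda_i(\boldsymbol{n})}\,\frac{(-q)_{n_1+n_2+\cdots+n_{k-1}+\frac{n_k+n_{k+1}}{2}}}{(q)_{n_1}(q)_{n_2}\cdots(q)_{n_{k+1}}}.$$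
   Context: Conventions: $q=e^{2\pi i\tau}$ with $\operatorname{Im}\tau>0$ (so $|q|<1$), and $q^r:=e^{2\pi i r\tau}$ for rational $r$ (here, in $e^{2\pi i\tau}$, $i$ is the imaginary unit; elsewhere $i$ is an integer index). The $q$-Pochhammer symbols are $(a)_n=(a;q)_n:=\prod_{j=1}^n(1-aq^{j-1})$ for $n\ge0$, $(a)_\infty:=\prod_{j\ge1}(1-aq^{j-1})$. Empty sums (upper limit less than lower limit) are zero. The symmetric $(k+1)\times(k+1)$ matrix $A^{-1}$ has entries $(A^{-1})_{r,s}=\min\{2r-1,2s-1\}$ for $1\le r,s\le k-1$; $(A^{-1})_{r,s}=(A^{-1})_{s,r}=\frac{2s-1}{2}$ for $1\le s\le k-1$ and $r\in\{k,k+1\}$; $(A^{-1})_{k,k}=(A^{-1})_{k+1,k+1}=\frac{2k+1}{4}$; $(A^{-1})_{k,k+1}=(A^{-1})_{k+1,k}=\frac{2k-3}{4}$. For $k=1$ this is $\begin{pmatrix}\frac34&-\frac14\\-\frac14&\frac34\end{pmatrix}$. For $k\ge2$ it is the inverse of $A=\frac12(D_{k+1}+E_{1,1})$, where $D_{k+1}$ is the Cartan matrix of type $D_{k+1}$ (with the last two nodes $k$ and $k+1$ both attached to node $k-1$) and $E_{1,1}$ is the matrix unit. *)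

theory Defs
  imports "HOL-Analysis.Analysis" "HOL-Number_Theory.Cong"
begin

text \<open>
  The power \<open>q\<^sup>r\<close> of the nome \<open>q = exp (2 \<pi> \<i> \<tau>)\<close>. For non-integral \<open>r\<close> it depends
  on \<open>\<tau>\<close> and not only on \<open>q\<close>, so it is a function of \<open>\<tau>\<close> (and not \<open>q powr r\<close>).
\<close>
definition qpow :: "complex \<Rightarrow> real \<Rightarrow> complex" where
  "qpow \<tau> r = exp (2 * of_real pi * \<i> * of_real r * \<tau>)"

definition qpoch :: "complex \<Rightarrow> complex \<Rightarrow> nat \<Rightarrow> complex" where
  "qpoch a q n = (\<Prod>j=1..n. 1 - a * q ^ (j - 1))"

text \<open>The product over \<open>j \<ge> 1\<close> of \<open>1 - a q\<^bsup>j - 1\<^esup>\<close>, re-indexed to start at \<open>0\<close>.\<close>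
definition qpoch_inf :: "complex \<Rightarrow> complex \<Rightarrow> complex" where
  "qpoch_inf a q = (\<Prod>j. 1 - a * q ^ j)"

text \<open>
  The entries \<open>(A\<^sup>-\<^sup>1)\<^bsub>r,s\<^esub>\<close> for \<open>1 \<le> r, s \<le> k + 1\<close>; the values at other indices are
  irrelevant.
\<close>
definition Ainv :: "nat \<Rightarrow> nat \<Rightarrow> nat \<Rightarrow> real" where
  "Ainv k r s =
     (if r \<le> k - 1 \<and> s \<le> k - 1 then min (2 * real r - 1) (2 * real s - 1)
      else if s \<le> k - 1 then (2 * real s - 1) / 2
      else if r \<le> k - 1 then (2 * real r - 1) / 2
      else if r = s then (2 * real k + 1) / 4
      else (2 * real k - 3) / 4)"

definition quad_form :: "nat \<Rightarrow> (nat \<Rightarrow> nat) \<Rightarrow> real" where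
  "quad_form k n = (\<Sum>r=1..k+1. \<Sum>s=1..k+1. real (n r) * Ainv k r s * real (n s))"

text \<open>Used only for \<open>1 \<le> k\<close> and \<open>i \<le> k\<close>, where the subtractions on \<open>nat\<close> do not truncate.\<close>
definition lambda_lin :: "nat \<Rightarrow> nat \<Rightarrow> (nat \<Rightarrow> nat) \<Rightarrow> real" where
  "lambda_lin k i n =
     - (1 / 2) * (\<Sum>j=1..min (k - i) (k - 1). real (n j))
     + (\<Sum>j=k-i+1..k-1. (2 * (real j - real k + real i) - 1) / 2 * real (n j))
     + (2 * real i - 1) / 4 * (real (n k) + real (n (k + 1)))"

text \<open>
  Tuples \<open>(n\<^sub>1, \<dots>, n\<^bsub>k+1\<^esub>)\<close> of natural numbers with \<open>n\<^sub>k\<close> and \<open>n\<^bsub>k+1\<^esub>\<close> of the same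
  parity, as extensional functions on \<open>{1..k+1}\<close> (so each tuple is represented once).
\<close>
definition parity_tuples :: "nat \<Rightarrow> (nat \<Rightarrow> nat) set" where
  "parity_tuples k = {n \<in> {1..k+1} \<rightarrow>\<^sub>E UNIV. [n k = n (k + 1)] (mod 2)}"

definition theta_term :: "nat \<Rightarrow> nat \<Rightarrow> complex \<Rightarrow> int \<Rightarrow> complex" where
  "theta_term k i \<tau> n =
     (2 * of_int n + 1)
     * qpow \<tau> ((2 * real k + 1) / 2 * (of_int n + (2 * real i - 1) / (4 * real k + 2))\<^sup>2)
     * (1 + qpow \<tau> (of_int n))"

text \<open>
  On \<open>parity_tuples k\<close> the sum \<open>n\<^sub>k + n\<^bsub>k+1\<^esub>\<close> is even, so \<open>div 2\<close> is exact there.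
\<close>
definition nahm_term :: "nat \<Rightarrow> nat \<Rightarrow> complex \<Rightarrow> (nat \<Rightarrow> nat) \<Rightarrow> complex" where
  "nahm_term k i \<tau> n = (let q = qpow \<tau> 1 in
     qpow \<tau> (quad_form k n / 2 + lambda_lin k i n)
     * qpoch (- q) q ((\<Sum>j=1..k-1. n j) + (n k + n (k + 1)) div 2)
     / (\<Prod>j=1..k+1. qpoch q q (n j)))"

end

theory Submission
  imports Defs
begin

text \<open>
  Put \<open>M\<^sub>j = n\<^sub>j + \<dots> + n\<^bsub>k-1\<^esub> + (n\<^sub>k + n\<^bsub>k+1\<^esub>) / 2\<close> for \<open>1 \<le> j \<le> k\<close> and \<open>D = (n\<^sub>k - n\<^bsub>k+1\<^esub>) / 2\<close>. By
  \<open>quad_form_eq\<close> and \<open>lambda_lin_eq\<close>, the exponent on the multisum side is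
  \<open>M\<^sub>1 (M\<^sub>1 - 1) / 2 + M\<^sub>2\<^sup>2 + \<dots> + M\<^sub>k\<^sup>2 + D\<^sup>2\<close> plus the sum of the \<open>M\<^sub>j\<close> over the last \<open>i\<close> indices
  \<open>k - i < j \<le> k\<close>. So the multisum is an iterated sum over \<open>M\<^sub>k \<le> M\<^bsub>k-1\<^esub> \<le> \<dots> \<le> M\<^sub>1\<close> with innermost
  sum over \<open>D\<close>, and it is evaluated by a Bailey chain started at \<open>D\<close>.

  The chain acts on the sums \<open>\<Sum>\<^sub>r c\<^sub>r / ((q)\<^bsub>M-r\<^esub> (q)\<^bsub>M+r+e\<^esub>)\<close> over all integers \<open>r\<close>, where \<open>e = 0\<close>
  corresponds to Bailey pairs relative to \<open>a = 1\<close> and \<open>e = 1\<close> to \<open>a = q\<close>. Summation of these against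
  \<open>q\<^bsup>M\<^sup>2 + e M\<^esup> / (q)\<^bsub>L-M\<^esub>\<close> multiplies \<open>c\<^sub>r\<close> by \<open>q\<^bsup>r\<^sup>2 + e r\<^esup>\<close> (\<open>bailey_step\<close>). The sum over \<open>D\<close> belongs to
  \<open>c\<^sub>r = q\<^bsup>r\<^sup>2\<^esup>\<close> with \<open>e = 0\<close>, and by the symmetry \<open>r \<mapsto> - r\<close> it equals the one for
  \<open>c\<^sub>r = (2 r + 1) q\<^bsup>r\<^sup>2\<^esup>\<close>; this is the origin of the factor \<open>2 n + 1\<close> in the theta series. The latter
  sequence has the antisymmetry \<open>q\<^bsup>- 1 - r\<^esup> c\<^bsub>- 1 - r\<^esub> = - q\<^sup>r c\<^sub>r\<close>, which steps with \<open>e = 1\<close> preserve,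
  and for such sequences the sums with \<open>e = 0\<close> and \<open>e = 1\<close> coincide (\<open>bailey_sum_change_parameter\<close>).
  Hence one performs the steps that contain a linear term \<open>M\<^sub>j\<close> with \<open>e = 1\<close>, and then the remaining
  ones with \<open>e = 0\<close> (\<open>sum_tail_tuples\<close>).

  The outermost sum over \<open>M\<^sub>1\<close>, with the factor \<open>(-q)\<^bsub>M\<^sub>1\<^esub>\<close>, is infinite (\<open>bailey_limit\<close>) and yields the
  theta series times \<open>(-q)\<^sub>\<infinity> / (q)\<^sub>\<infinity>\<close>. For \<open>i = k\<close> it is taken with \<open>e = 1\<close>, and only the part
  of the theta series belonging to the summand \<open>1\<close> of \<open>1 + q\<^sup>n\<close> arises; the other part vanishes because its terms
  are odd under \<open>n \<mapsto> - 1 - n\<close> (\<open>infsum_theta_odd\<close>).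

  Both kinds of summation over \<open>M\<close> are instances of one terminating sum, \<open>q_chu_vandermonde\<close>, and of its
  limit \<open>q_gauss_limit\<close>.
\<close>

section \<open>The \<open>q\<close>-Chu-Vandermonde sum and its limit\<close>

lemma qpoch_0 [simp]: "qpoch a q 0 = 1"
  by (simp add: qpoch_def)

lemma qpoch_Suc: "qpoch a q (Suc n) = qpoch a q n * (1 - a * q ^ n)"
  by (simp add: qpoch_def)

lemma qpoch_altdef: "qpoch a q n = (\<Prod>j<n. 1 - a * q ^ j)"
  by (induction n) (simp_all add: qpoch_Suc)

lemma qpoch_add: "qpoch a q (m + n) = qpoch a q m * qpoch (a * q ^ m) q n"
  by (induction n) (simp_all add: qpoch_Suc power_add mult_ac)

lemma qpoch_Suc_left: "qpoch a q (Suc n) = (1 - a) * qpoch (a * q) q n"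
  using qpoch_add[of a q 1 n] by (simp add: qpoch_Suc)

lemma qpoch_nonzero:
  assumes "\<And>m. a * q ^ m \<noteq> 1"
  shows "qpoch a q n \<noteq> 0"
  using assms by (auto simp: qpoch_altdef)

lemma mult_power_neq_1:
  fixes a q :: complex
  assumes "norm q < 1" "norm a < 1"
  shows "a * q ^ m \<noteq> 1"
proof
  assume *: "a * q ^ m = 1"
  have "norm (a * q ^ m) \<le> norm a * 1"
    unfolding norm_mult norm_power using assms
    by (intro mult_left_mono power_le_one) auto
  with * assms show False by simp
qed

lemma qpoch_nonzero':
  assumes "norm q < 1" "norm a < 1"
  shows "qpoch a q n \<noteq> 0"
  by (intro qpoch_nonzero mult_power_neq_1 assms)

lemma prod_factored:
  fixes x y q :: complex
  shows "(\<Prod>m<j. x + x * y * q ^ m) = x ^ j * qpoch (- y) q j"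
  by (induction j) (simp_all add: qpoch_Suc algebra_simps)

lemma prod_power_choose_two:
  fixes x q :: complex
  shows "(\<Prod>m<j. x * q ^ m) = x ^ j * q ^ (j choose 2)"
  by (induction j) (simp_all add: binomial_eq_0 numeral_2_eq_2 power_add mult_ac)

lemma choose_two_add: "(r + j choose 2) = (r choose 2) + (j choose 2) + r * j"
  by (induction j) (simp_all add: numeral_2_eq_2)

lemma two_choose_two: "2 * (j choose 2) + j = j * j"
  by (induction j) (simp_all add: numeral_2_eq_2)

text \<open>
  The \<open>q\<close>-Chu-Vandermonde sum for \<open>\<^sub>2\<phi>\<^sub>1(q\<^bsup>-n\<^esup>, b; c; q, c q\<^sup>n / b)\<close>, divided by \<open>(q)\<^sub>n\<close> and written with
  \<open>Z = - c / b\<close> in place of \<open>b\<close>. In this form \<open>Z = 0\<close> (that is, \<open>b = \<infinity>\<close>) is allowed. The \<open>q\<close>-Pascal rule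
  expresses the sum for \<open>n + 1\<close> at \<open>(Z, c)\<close> by the sum for \<open>n\<close> at \<open>(Z q, c q)\<close>.
\<close>
lemma q_chu_vandermonde:
  fixes q c Z :: complex
  assumes q: "norm q < 1" and c: "\<And>m. c * q ^ m \<noteq> 1"
  shows "(\<Sum>j\<le>n. q ^ (j choose 2) * (\<Prod>m<j. Z + c * q ^ m) /
            (qpoch q q j * qpoch q q (n - j) * qpoch c q j))
         = qpoch (- Z) q n / (qpoch q q n * qpoch c q n)"
  using c
proof (induction n arbitrary: Z c)
  case 0
  then show ?case by (simp add: binomial_eq_0)
next
  case (Suc n Z c)
  define X where "X = (\<lambda>j. q ^ (j choose 2) * (\<Prod>m<j. Z + c * q ^ m) / qpoch c q j)"
  define t where "t = (\<lambda>n j. 1 / (qpoch q q j * qpoch q q (n - j)))"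
  note nz = qpoch_nonzero'[OF q q]
  have nz1: "1 - q * q ^ m \<noteq> 0" for m
    using mult_power_neq_1[OF q q, of m] by simp
  have c1: "1 - c * q ^ m \<noteq> 0" for m
    using Suc.prems[of m] by simp
  have cq: "c * q * q ^ m \<noteq> 1" for m
    using Suc.prems[of "Suc m"] by (simp add: mult_ac)
  have nzc: "qpoch c q m \<noteq> 0" "qpoch (c * q) q m \<noteq> 0" for m
    using qpoch_nonzero[of c q m, OF Suc.prems] qpoch_nonzero[of "c * q" q m, OF cq] by auto
  have A: "(1 - q * q ^ n) * t (Suc n) 0 = t n 0"
    using nz1[of n] nz by (simp add: t_def qpoch_Suc)
  have B: "(1 - q * q ^ n) * t (Suc n) (Suc n) = t n n"
    using nz1[of n] nz by (simp add: t_def qpoch_Suc)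
  have pascal: "(1 - q * q ^ n) * t (Suc n) (Suc j) = q ^ Suc j * t n (Suc j) + t n j" if j: "j < n" for j
  proof -
    obtain d where d: "n = Suc (j + d)" using j less_iff_Suc_add by auto
    have e: "1 - q * q ^ n = q ^ Suc j * (1 - q * q ^ d) + (1 - q * q ^ j)"
      by (simp add: d power_add algebra_simps)
    have frac: "(x * v + u) * (1 / ((A * u) * (B * v))) = x * (1 / ((A * u) * B)) + 1 / (A * (B * v))"
      if "u \<noteq> 0" "v \<noteq> 0" for x u v A B :: complex
      using that by (cases "A = 0"; cases "B = 0") (simp_all add: field_simps)
    show ?thesis
      unfolding e using frac[OF nz1[of j] nz1[of d]]
      by (simp add: t_def d qpoch_Suc Suc_diff_le del: power_Suc)
  qed
  have step: "q ^ j * X j + X (Suc j) = (1 + Z) / (1 - c) *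
      (q ^ (j choose 2) * (\<Prod>m<j. Z * q + c * q * q ^ m) / qpoch (c * q) q j)" for j
  proof -
    have ch: "Suc j choose 2 = (j choose 2) + j" by (simp add: numeral_2_eq_2)
    have P: "(\<Prod>m<j. Z * q + c * q * q ^ m) = q ^ j * (\<Prod>m<j. Z + c * q ^ m)"
      by (induction j) (simp_all add: algebra_simps)
    have Q: "qpoch c q j * (1 - c * q ^ j) = (1 - c) * qpoch (c * q) q j"
      using qpoch_Suc[of c q j] qpoch_Suc_left[of c q j] by simp
    have "q ^ j * X j + X (Suc j) =
       q ^ (j choose 2) * (q ^ j * (\<Prod>m<j. Z + c * q ^ m)) * (1 + Z) / (qpoch c q j * (1 - c * q ^ j))"
      using c1[of j] nzc[of j] by (simp add: X_def ch qpoch_Suc power_add field_simps)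
    also have "\<dots> = (1 + Z) / (1 - c) *
      (q ^ (j choose 2) * (\<Prod>m<j. Z * q + c * q * q ^ m) / qpoch (c * q) q j)"
      unfolding Q P by simp
    finally show ?thesis .
  qed
  have "(1 - q * q ^ n) * (\<Sum>j\<le>Suc n. t (Suc n) j * X j)
      = (\<Sum>j\<le>n. q ^ j * t n j * X j) + (\<Sum>j\<le>n. t n j * X (Suc j))"
  proof -
    have "(1 - q * q ^ n) * (\<Sum>j\<le>Suc n. t (Suc n) j * X j)
       = (1 - q * q ^ n) * t (Suc n) 0 * X 0 + (\<Sum>j\<le>n. (1 - q * q ^ n) * t (Suc n) (Suc j) * X (Suc j))"
      by (simp only: sum.atMost_Suc_shift distrib_left sum_distrib_left mult.assoc)
    also have "(\<Sum>j\<le>n. (1 - q * q ^ n) * t (Suc n) (Suc j) * X (Suc j))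
       = (\<Sum>j<n. (q ^ Suc j * t n (Suc j) + t n j) * X (Suc j)) + t n n * X (Suc n)"
    proof -
      have "{..n} = insert n {..<n}" by auto
      then show ?thesis using pascal B by (simp del: power_Suc)
    qed
    also have "\<dots> = (\<Sum>j<n. q ^ Suc j * t n (Suc j) * X (Suc j)) + (\<Sum>j\<le>n. t n j * X (Suc j))"
      by (simp add: algebra_simps sum.distrib lessThan_Suc_atMost[symmetric])
    also have "(1 - q * q ^ n) * t (Suc n) 0 * X 0 = q ^ 0 * t n 0 * X 0"
      by (simp add: A)
    also have "q ^ 0 * t n 0 * X 0 + ((\<Sum>j<n. q ^ Suc j * t n (Suc j) * X (Suc j)) + (\<Sum>j\<le>n. t n j * X (Suc j)))
       = (\<Sum>j\<le>n. q ^ j * t n j * X j) + (\<Sum>j\<le>n. t n j * X (Suc j))"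
      by (simp only: lessThan_Suc_atMost[symmetric] sum.lessThan_Suc_shift add.assoc)
    finally show ?thesis .
  qed
  also have "\<dots> = (\<Sum>j\<le>n. t n j * (q ^ j * X j + X (Suc j)))"
    by (simp add: sum.distrib algebra_simps)
  also have "\<dots> = (1 + Z) / (1 - c) * (\<Sum>j\<le>n. q ^ (j choose 2) * (\<Prod>m<j. Z * q + c * q * q ^ m) /
            (qpoch q q j * qpoch q q (n - j) * qpoch (c * q) q j))"
    unfolding step sum_distrib_left by (intro sum.cong) (simp_all add: t_def field_simps)
  also have "\<dots> = (1 + Z) / (1 - c) * (qpoch (- (Z * q)) q n / (qpoch q q n * qpoch (c * q) q n))"
    by (subst Suc.IH) (use cq in auto)
  also have "\<dots> = qpoch (- Z) q (Suc n) / (qpoch q q n * qpoch c q (Suc n))"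
    by (simp add: qpoch_Suc_left)
  finally have main: "(1 - q * q ^ n) * (\<Sum>j\<le>Suc n. t (Suc n) j * X j) =
      qpoch (- Z) q (Suc n) / (qpoch q q n * qpoch c q (Suc n))" .
  have "(\<Sum>j\<le>Suc n. q ^ (j choose 2) * (\<Prod>m<j. Z + c * q ^ m) /
            (qpoch q q j * qpoch q q (Suc n - j) * qpoch c q j)) = (\<Sum>j\<le>Suc n. t (Suc n) j * X j)"
    by (intro sum.cong) (simp_all add: t_def X_def)
  also have "\<dots> = qpoch (- Z) q (Suc n) / (qpoch q q n * qpoch c q (Suc n)) / (1 - q * q ^ n)"
    using main nz1[of n] by (metis nonzero_mult_div_cancel_left)
  also have "\<dots> = qpoch (- Z) q (Suc n) / (qpoch q q (Suc n) * qpoch c q (Suc n))"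
    by (simp add: qpoch_Suc[of q q n])
  finally show ?case .
qed

lemma convergent_prod_qpoch:
  fixes a q :: complex
  assumes "norm q < 1"
  shows "convergent_prod (\<lambda>j. 1 - a * q ^ j)"
proof -
  have "summable (\<lambda>i. norm ((1 - a * q ^ i) - 1))"
    using assms by (simp add: norm_mult norm_power summable_mult summable_geometric)
  then show ?thesis
    by (intro abs_convergent_prod_imp_convergent_prod summable_imp_abs_convergent_prod)
qed

lemma qpoch_LIMSEQ:
  assumes "norm q < 1"
  shows "qpoch a q \<longlonglongrightarrow> qpoch_inf a q"
proof -
  have "(\<lambda>n. qpoch a q (Suc n)) \<longlonglongrightarrow> qpoch_inf a q"
    using convergent_prod_LIMSEQ[OF convergent_prod_qpoch[OF assms, of a]]
    by (simp add: qpoch_altdef qpoch_inf_def lessThan_Suc_atMost)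
  then show ?thesis by (rule LIMSEQ_imp_Suc)
qed

lemma qpoch_inf_nonzero:
  assumes "norm q < 1" "\<And>m. a * q ^ m \<noteq> 1"
  shows "qpoch_inf a q \<noteq> 0"
  unfolding qpoch_inf_def using assms
  by (intro prodinf_nonzero convergent_prod_qpoch) auto

lemma qpoch_inf_split:
  assumes "norm q < 1"
  shows "qpoch_inf a q = qpoch a q n * qpoch_inf (a * q ^ n) q"
proof (rule LIMSEQ_unique)
  show "(\<lambda>m. qpoch a q (m + n)) \<longlonglongrightarrow> qpoch_inf a q"
    using qpoch_LIMSEQ[OF assms] by (rule LIMSEQ_ignore_initial_segment)
  show "(\<lambda>m. qpoch a q (m + n)) \<longlonglongrightarrow> qpoch a q n * qpoch_inf (a * q ^ n) q"
    unfolding add.commute[of _ n] qpoch_add by (intro tendsto_intros qpoch_LIMSEQ assms)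
qed

lemma qpoch_bounded:
  fixes a q :: complex
  assumes "norm q < 1"
  obtains C where "C > 0" "\<And>n. norm (qpoch a q n) \<le> C"
proof -
  have "Bseq (qpoch a q)"
    using qpoch_LIMSEQ[OF assms] convergent_imp_Bseq convergentI by blast
  then show ?thesis using that by (auto simp: Bseq_def)
qed

lemma inverse_qpoch_bounded:
  fixes q :: complex
  assumes "norm q < 1"
  obtains C where "C > 0" "\<And>n. norm (1 / qpoch q q n) \<le> C"
proof -
  have "(\<lambda>n. 1 / qpoch q q n) \<longlonglongrightarrow> 1 / qpoch_inf q q"
    using assms by (intro tendsto_intros qpoch_LIMSEQ qpoch_inf_nonzero mult_power_neq_1)
  then have "Bseq (\<lambda>n. 1 / qpoch q q n)"
    using convergent_imp_Bseq convergentI by blast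
  then show ?thesis using that unfolding Bseq_def by blast
qed

text \<open>
  The limit \<open>n \<rightarrow> \<infinity>\<close> of the finite sum, by dominated convergence: the sum of a series
  \<open>\<^sub>1\<phi>\<^sub>1(b; c; q, c / b)\<close>, again with \<open>Z = - c / b\<close>.
\<close>
lemma q_gauss_limit:
  fixes q c Z :: complex
  assumes q: "norm q < 1" and c: "\<And>m. c * q ^ m \<noteq> 1"
  shows "(\<lambda>j. q ^ (j choose 2) * (\<Prod>m<j. Z + c * q ^ m) / (qpoch q q j * qpoch c q j))
           sums (qpoch_inf (- Z) q / qpoch_inf c q)"
proof -
  define X where "X = (\<lambda>j. q ^ (j choose 2) * (\<Prod>m<j. Z + c * q ^ m) / (qpoch q q j * qpoch c q j))"
  define a where "a = (\<lambda>j n. if j \<le> n then X j * (qpoch q q n * (1 / qpoch q q (n - j))) else 0)"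
  note nz = qpoch_nonzero'[OF q q]
  have nzc: "qpoch c q n \<noteq> 0" for n using c by (rule qpoch_nonzero)
  obtain C1 where C1: "C1 > 0" "\<And>n. norm (qpoch q q n) \<le> C1"
    using qpoch_bounded[OF q] by blast
  obtain C2 where C2: "C2 > 0" "\<And>n. norm (1 / qpoch q q n) \<le> C2"
    using inverse_qpoch_bounded[OF q] by blast
  have qinf: "qpoch_inf q q \<noteq> 0" "qpoch_inf c q \<noteq> 0"
    using qpoch_inf_nonzero[OF q mult_power_neq_1[OF q q]] qpoch_inf_nonzero[OF q c] by auto
  have summX: "summable (\<lambda>j. norm (X j))"
  proof -
    define \<rho> where "\<rho> = (\<lambda>j. q ^ j * (Z + c * q ^ j) / ((1 - q * q ^ j) * (1 - c * q ^ j)))"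
    have ratio: "X (Suc j) = \<rho> j * X j" for j
    proof -
      have ch: "Suc j choose 2 = (j choose 2) + j" by (simp add: numeral_2_eq_2)
      show ?thesis by (simp add: X_def \<rho>_def ch qpoch_Suc power_add divide_inverse mult_ac)
    qed
    have pw: "(\<lambda>j. q ^ j) \<longlonglongrightarrow> 0" using q by (rule LIMSEQ_power_zero)
    have "\<rho> \<longlonglongrightarrow> 0 * (Z + c * 0) / ((1 - q * 0) * (1 - c * 0))"
      unfolding \<rho>_def by (intro tendsto_intros pw) auto
    then have "\<rho> \<longlonglongrightarrow> 0" by simp
    then have "eventually (\<lambda>j. norm (\<rho> j) < 1 / 2) sequentially"
      by (auto simp: tendsto_iff dest: spec[of _ "1/2"])
    then obtain N where N: "\<And>j. j \<ge> N \<Longrightarrow> norm (\<rho> j) < 1 / 2"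
      by (auto simp: eventually_sequentially)
    show ?thesis
    proof (rule summable_ratio_test)
      show "norm (norm (X (Suc n))) \<le> 1 / 2 * norm (norm (X n))" if "N \<le> n" for n
        using mult_right_mono[OF less_imp_le[OF N[OF that]], of "norm (X n)"]
        by (simp add: ratio norm_mult)
    qed simp
  qed
  have lim: "(\<lambda>n. a j n) \<longlonglongrightarrow> X j" for j
  proof -
    have "(\<lambda>n. X j * (qpoch q q (n + j) * (1 / qpoch q q n))) \<longlonglongrightarrow> X j * (qpoch_inf q q * (1 / qpoch_inf q q))"
      by (intro tendsto_intros LIMSEQ_ignore_initial_segment qpoch_LIMSEQ q qinf)
    also have "X j * (qpoch_inf q q * (1 / qpoch_inf q q)) = X j" using qinf by simp
    also have "(\<lambda>n. X j * (qpoch q q (n + j) * (1 / qpoch q q n))) = (\<lambda>n. a j (n + j))"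
      by (simp add: a_def)
    finally show ?thesis by (rule LIMSEQ_offset)
  qed
  have bound: "norm (a j n) \<le> norm (X j) * (C1 * C2)" for j n
  proof (cases "j \<le> n")
    case True
    have "norm (a j n) = norm (X j) * (norm (qpoch q q n) * norm (1 / qpoch q q (n - j)))"
      using True by (simp add: a_def norm_mult norm_divide)
    also have "\<dots> \<le> norm (X j) * (C1 * C2)"
      using C1 C2 by (intro mult_left_mono mult_mono) auto
    finally show ?thesis .
  qed (use C1 C2 in \<open>auto simp: a_def\<close>)
  have suma: "suminf (\<lambda>j. a j n) = qpoch (- Z) q n / qpoch c q n" for n
  proof -
    have "suminf (\<lambda>j. a j n) = (\<Sum>j\<le>n. a j n)"
      by (rule suminf_finite) (auto simp: a_def)
    also have "\<dots> = qpoch q q n * (\<Sum>j\<le>n. q ^ (j choose 2) * (\<Prod>m<j. Z + c * q ^ m) /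
            (qpoch q q j * qpoch q q (n - j) * qpoch c q j))"
      unfolding sum_distrib_left by (intro sum.cong) (auto simp: a_def X_def mult_ac)
    also have "\<dots> = qpoch (- Z) q n / qpoch c q n"
      by (subst q_chu_vandermonde) (use q c nz in auto)
    finally show ?thesis .
  qed
  have "(\<lambda>n. suminf (\<lambda>j. a j n)) \<longlonglongrightarrow> suminf X"
  proof -
    have "eventually (\<lambda>(j, n). norm (a j n) \<le> norm (X j) * (C1 * C2)) (at_top \<times>\<^sub>F sequentially)"
      using bound by (intro always_eventually) auto
    from tannerys_theorem[OF lim this summable_mult2[OF summX] sequentially_bot]
    show ?thesis by blast
  qed
  moreover have "(\<lambda>n. qpoch (- Z) q n / qpoch c q n) \<longlonglongrightarrow> qpoch_inf (- Z) q / qpoch_inf c q"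
    by (intro tendsto_intros qpoch_LIMSEQ q qinf)
  ultimately have "suminf X = qpoch_inf (- Z) q / qpoch_inf c q"
    unfolding suma by (rule LIMSEQ_unique)
  moreover have "X sums suminf X"
    using summable_norm_cancel[OF summX] by (rule summable_sums)
  ultimately show ?thesis by (simp add: X_def)
qed

section \<open>The Bailey chain for bilateral sequences\<close>

text \<open>
  The powers of \<open>q\<close> with real exponent depend on \<open>\<tau>\<close>, hence both are fixed.
\<close>
locale nome =
  fixes \<tau> q :: complex
  assumes Im_pos: "Im \<tau> > 0" and q_eq: "q = qpow \<tau> 1"
begin

abbreviation Q :: "real \<Rightarrow> complex" where "Q \<equiv> qpow \<tau>"

lemma Q_add: "Q (a + b) = Q a * Q b"
  by (simp add: qpow_def exp_add [symmetric] algebra_simps)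

lemma Q_0 [simp]: "Q 0 = 1"
  by (simp add: qpow_def)

lemma Q_nonzero [simp]: "Q a \<noteq> 0"
  by (simp add: qpow_def)

lemma Q_of_nat: "Q (real n) = q ^ n"
  by (induction n) (simp_all add: Q_add q_eq)

lemma norm_q_less_1: "norm q < 1"
  using Im_pos by (simp add: q_eq qpow_def norm_exp_eq_Re mult_pos_pos)

lemma q_nonzero: "q \<noteq> 0"
  by (simp add: q_eq)

lemma norm_Q: "norm (Q r) = norm q powr r"
  using q_nonzero by (simp add: q_eq qpow_def norm_exp_eq_Re powr_def mult_ac)

lemma norm_Q_antimono: "a \<le> b \<Longrightarrow> norm (Q b) \<le> norm (Q a)"
  unfolding norm_Q using norm_q_less_1 by (intro powr_mono') auto

lemma qq_neq_1: "q * q ^ m \<noteq> 1"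
  by (intro mult_power_neq_1 norm_q_less_1)

text \<open>
  The reciprocal \<open>1 / (q)\<^sub>m\<close>, extended by \<open>0\<close> to negative \<open>m\<close>. With this convention the
  recurrence \<open>rqpoch_rec\<close> holds for all integers, and sums against it have natural boundaries.
\<close>
definition rqpoch :: "int \<Rightarrow> complex" where
  "rqpoch m = (if m < 0 then 0 else 1 / qpoch q q (nat m))"

lemma rqpoch_of_nat [simp]: "rqpoch (int n) = 1 / qpoch q q n"
  by (simp add: rqpoch_def)

lemma rqpoch_neg: "m < 0 \<Longrightarrow> rqpoch m = 0"
  by (simp add: rqpoch_def)

lemma rqpoch_rec: "rqpoch (m - 1) = (1 - Q (of_int m)) * rqpoch m"
proof (cases "m \<le> 0")
  case True
  then show ?thesis by (cases "m = 0") (simp_all add: rqpoch_neg)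
next
  case False
  then obtain n where n: "m = int (Suc n)"
    by (metis gr0_conv_Suc not_le zero_less_imp_eq_int)
  then have m1: "m - 1 = int n" by simp
  have "Q (of_int m) = q * q ^ n" using Q_of_nat[of "Suc n"] n by simp
  then show ?thesis
    unfolding m1 unfolding n rqpoch_of_nat qpoch_Suc using qq_neq_1[of n] by simp
qed

lemma rqpoch_bounded:
  obtains C where "C > 0" "\<And>m. norm (rqpoch m) \<le> C"
proof -
  obtain C where "C > 0" "\<And>n. norm (1 / qpoch q q n) \<le> C"
    using inverse_qpoch_bounded[OF norm_q_less_1] by blast
  then have "norm (rqpoch m) \<le> C" for m by (simp add: rqpoch_def)
  with \<open>C > 0\<close> show ?thesis using that by blast
qed

lemma qpoch_qq_add: "qpoch q q (a + j) = qpoch q q a * qpoch (q ^ Suc a) q j"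
  by (simp add: qpoch_add)

text \<open>After the shift \<open>M = r + j\<close> this is \<open>q_chu_vandermonde\<close> with \<open>Z = 0\<close> and \<open>c = q\<^bsup>2r+e+1\<^esup>\<close>.\<close>
lemma sum_rqpoch3_nat:
  "(\<Sum>M\<le>L. q ^ (M * M + e * M) * rqpoch (int L - int M) * (rqpoch (int M - int r) * rqpoch (int M + int r + int e)))
    = q ^ (r * r + e * r) * (rqpoch (int L - int r) * rqpoch (int L + int r + int e))"
proof (cases "r \<le> L")
  case False
  then show ?thesis by (auto simp: rqpoch_neg intro!: sum.neutral)
next
  case True
  then obtain n where n: "L = r + n" by (auto simp: le_iff_add)
  define a where "a = 2 * r + e"
  let ?f = "\<lambda>M. q ^ (M * M + e * M) * rqpoch (int L - int M) * (rqpoch (int M - int r) * rqpoch (int M + int r + int e))"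
  have "(\<Sum>M\<le>L. ?f M) = (\<Sum>M\<in>{r..r+n}. ?f M)"
    by (rule sum.mono_neutral_right) (auto simp: n rqpoch_neg)
  also have "\<dots> = (\<Sum>j\<le>n. ?f (r + j))"
    using sum.shift_bounds_cl_nat_ivl[of ?f 0 r n] by (simp add: add.commute atLeast0AtMost)
  also have "\<dots> = (\<Sum>j\<le>n. q ^ (r * r + e * r) / qpoch q q a * (q ^ (j choose 2) * (\<Prod>m<j. 0 + q ^ Suc a * q ^ m) /
            (qpoch q q j * qpoch q q (n - j) * qpoch (q ^ Suc a) q j)))"
  proof (intro sum.cong refl)
    fix j assume j: "j \<in> {..n}"
    have i: "int L - int (r + j) = int (n - j)" "int (r + j) - int r = int j"
      "int (r + j) + int r + int e = int (a + j)" using j by (auto simp: n a_def)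
    have "(r + j) * (r + j) + e * (r + j) = (r * r + e * r) + ((j choose 2) + Suc a * j + (j choose 2))"
      using two_choose_two[of j] by (simp add: a_def algebra_simps)
    then have p: "q ^ ((r + j) * (r + j) + e * (r + j))
       = q ^ (r * r + e * r) * (q ^ (j choose 2) * ((q ^ Suc a) ^ j * q ^ (j choose 2)))"
      by (simp only: power_add power_mult mult.assoc)
    show "?f (r + j) = q ^ (r * r + e * r) / qpoch q q a * (q ^ (j choose 2) * (\<Prod>m<j. 0 + q ^ Suc a * q ^ m) /
            (qpoch q q j * qpoch q q (n - j) * qpoch (q ^ Suc a) q j))"
      unfolding i p rqpoch_of_nat qpoch_qq_add add_0_left prod_power_choose_two
      by (simp add: divide_inverse mult_ac del: power_Suc)
  qed
  also have "\<dots> = q ^ (r * r + e * r) / qpoch q q a * (qpoch (- 0) q n / (qpoch q q n * qpoch (q ^ Suc a) q n))"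
    unfolding sum_distrib_left [symmetric]
    by (subst q_chu_vandermonde[OF norm_q_less_1])
       (use qq_neq_1 in \<open>auto simp: power_add[symmetric] mult.assoc\<close>)
  also have "\<dots> = q ^ (r * r + e * r) * (rqpoch (int L - int r) * rqpoch (int L + int r + int e))"
  proof -
    have i: "int L - int r = int n" "int L + int r + int e = int (a + n)"
      by (auto simp: n a_def)
    have "qpoch 0 q n = 1" by (simp add: qpoch_def)
    then show ?thesis unfolding i rqpoch_of_nat qpoch_qq_add by simp
  qed
  finally show ?thesis .
qed

text \<open>
  The finite sum that drives the Bailey chain, relative to \<open>a = q\<^sup>e\<close>. For \<open>e \<le> 1\<close> the reflection
  \<open>r \<mapsto> - e - r\<close> maps the negative integers to natural numbers.
\<close>
lemma sum_rqpoch3: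
  assumes "e \<le> 1"
  shows "(\<Sum>M\<le>L. q ^ (M * M + e * M) * rqpoch (int L - int M) * (rqpoch (int M - r) * rqpoch (int M + r + int e)))
    = Q (of_int (r * r + e * r)) * (rqpoch (int L - r) * rqpoch (int L + r + int e))"
proof (cases "r \<ge> 0")
  case True
  then obtain n where n: "r = int n" by (metis nonneg_int_cases)
  show ?thesis using sum_rqpoch3_nat[of e L n] Q_of_nat[of "n * n + e * n"] by (simp add: n)
next
  case False
  then obtain n where n: "r = - int e - int n"
    using assms that[of "nat (- int e - r)"] by auto
  have r: "int M - r = int M + int n + int e" "int M + r + int e = int M - int n" for M
    by (auto simp: n)
  have "r * r + e * r = int (n * n + e * n)" by (simp add: n algebra_simps)
  then have Qr: "Q (of_int (r * r + e * r)) = q ^ (n * n + e * n)"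
    by (metis Q_of_nat of_int_of_nat_eq)
  show ?thesis unfolding r Qr using sum_rqpoch3_nat[of e L n] by (simp add: mult_ac)
qed

text \<open>
  For the bilateral sequence \<open>c\<close>, the quantity \<open>\<beta>\<^sub>M\<close> of a Bailey pair relative to \<open>a = q\<^sup>e\<close>, with
  \<open>(q)\<^bsub>M+r+e\<^esub>\<close> in place of \<open>(a q)\<^bsub>M+r\<^esub>\<close>. The summand vanishes outside the range of summation.
\<close>
definition bailey_sum :: "nat \<Rightarrow> (int \<Rightarrow> complex) \<Rightarrow> nat \<Rightarrow> complex" where
  "bailey_sum e c M = (\<Sum>r\<in>{- int M - int e..int M}. c r * (rqpoch (int M - r) * rqpoch (int M + r + int e)))"

lemma bailey_sum_superset:
  assumes "finite A" "{- int M - int e..int M} \<subseteq> A"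
  shows "bailey_sum e c M = (\<Sum>r\<in>A. c r * (rqpoch (int M - r) * rqpoch (int M + r + int e)))"
  unfolding bailey_sum_def using assms
  by (intro sum.mono_neutral_left) (auto simp: rqpoch_def)

lemma bailey_step:
  assumes "e \<le> 1"
  shows "(\<Sum>M\<le>L. q ^ (M * M + e * M) * rqpoch (int L - int M) * bailey_sum e c M)
     = bailey_sum e (\<lambda>r. Q (of_int (r * r + e * r)) * c r) L"
proof -
  let ?A = "{- int L - int e..int L}"
  have "(\<Sum>M\<le>L. q ^ (M * M + e * M) * rqpoch (int L - int M) * bailey_sum e c M)
    = (\<Sum>M\<le>L. \<Sum>r\<in>?A. c r * (q ^ (M * M + e * M) * rqpoch (int L - int M) * (rqpoch (int M - r) * rqpoch (int M + r + int e))))"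
  proof (intro sum.cong refl)
    fix M assume "M \<in> {..L}"
    then have "{- int M - int e..int M} \<subseteq> ?A" by auto
    then show "q ^ (M * M + e * M) * rqpoch (int L - int M) * bailey_sum e c M
      = (\<Sum>r\<in>?A. c r * (q ^ (M * M + e * M) * rqpoch (int L - int M) * (rqpoch (int M - r) * rqpoch (int M + r + int e))))"
      by (subst bailey_sum_superset[of ?A]) (auto simp: sum_distrib_left mult_ac intro!: sum.cong)
  qed
  also have "\<dots> = (\<Sum>r\<in>?A. c r * (\<Sum>M\<le>L. q ^ (M * M + e * M) * rqpoch (int L - int M) * (rqpoch (int M - r) * rqpoch (int M + r + int e))))"
    by (subst sum.swap) (simp add: sum_distrib_left)
  also have "\<dots> = bailey_sum e (\<lambda>r. Q (of_int (r * r + e * r)) * c r) L"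
    unfolding sum_rqpoch3[OF assms] bailey_sum_def by (intro sum.cong) (auto simp: mult_ac)
  finally show ?thesis .
qed

text \<open>
  For a sequence with this antisymmetry the change of parameter \<open>a = 1 \<leftrightarrow> a = q\<close> leaves both the
  sequence and its sums unchanged: the two sums differ by a sum that is odd under \<open>r \<mapsto> - 1 - r\<close>.
\<close>
lemma bailey_sum_change_parameter:
  assumes anti: "\<And>r. Q (of_int (- 1 - r)) * c (- 1 - r) = - (Q (of_int r) * c r)"
  shows "bailey_sum 0 c M = bailey_sum 1 c M"
proof -
  let ?A = "{- int M - int 1..int M}"
  let ?g = "\<lambda>r. (Q (of_int r) * c r) * (rqpoch (int M - r) * rqpoch (int M + r + 1))"
  have "sum ?g ?A = (\<Sum>r\<in>?A. - ?g r)"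
  proof (rule sum.reindex_bij_witness[of _ "\<lambda>r. - 1 - r" "\<lambda>r. - 1 - r"])
    fix r assume "r \<in> ?A"
    have "int M - (- 1 - r) = int M + r + 1" "int M + (- 1 - r) + 1 = int M - r" by auto
    then show "- ?g (- 1 - r) = ?g r" by (simp only: anti) simp
  qed auto
  then have zero: "sum ?g ?A = 0" by (simp add: sum_negf)
  have "bailey_sum 0 c M = (\<Sum>r\<in>?A. c r * (rqpoch (int M - r) * rqpoch (int M + r + int 0)))"
    by (rule bailey_sum_superset) auto
  also have "\<dots> = (\<Sum>r\<in>?A. c r * (rqpoch (int M - r) * rqpoch (int M + r + int 1)) - Q (real M + 1) * ?g r)"
  proof (intro sum.cong refl)
    fix r
    have "rqpoch (int M + r) = (1 - Q (real M + 1) * Q (of_int r)) * rqpoch (int M + r + 1)"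
    proof -
      have "Q (of_int (int M + r + 1)) = Q (real M + 1) * Q (of_int r)"
        by (subst Q_add [symmetric]) (simp add: add_ac)
      then show ?thesis using rqpoch_rec[of "int M + r + 1"] by simp
    qed
    then have *: "rqpoch (int M + r + int 0) = (1 - Q (real M + 1) * Q (of_int r)) * rqpoch (int M + r + 1)"
      by simp
    show "c r * (rqpoch (int M - r) * rqpoch (int M + r + int 0))
      = c r * (rqpoch (int M - r) * rqpoch (int M + r + int 1)) - Q (real M + 1) * ?g r"
      unfolding * of_nat_1 by (simp add: algebra_simps)
  qed
  also have "\<dots> = bailey_sum 1 c M - Q (real M + 1) * sum ?g ?A"
    by (simp add: sum_subtractf sum_distrib_left bailey_sum_def)
  finally show ?thesis using zero by simp
qed

text \<open>
  The infinite counterpart of \<open>sum_rqpoch3_nat\<close>: after the shift \<open>M = r + j\<close> it is the sum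
  \<open>q_gauss_limit\<close> with \<open>Z = q\<^bsup>r+e\<^esup>\<close> and \<open>c = q\<^bsup>2r+e+1\<^esup>\<close>.
\<close>
lemma rqpoch_sums_nat:
  "(\<lambda>M. q ^ ((M choose 2) + e * M) * qpoch (- q) q M * (rqpoch (int M - int r) * rqpoch (int M + int r + int e)))
     sums (q ^ ((r choose 2) + e * r) * (qpoch (- q) q r * qpoch_inf (- (q ^ (r + e))) q) / qpoch_inf q q)"
proof -
  define a where "a = 2 * r + e"
  let ?f = "\<lambda>M. q ^ ((M choose 2) + e * M) * qpoch (- q) q M * (rqpoch (int M - int r) * rqpoch (int M + int r + int e))"
  let ?C = "q ^ ((r choose 2) + e * r) * qpoch (- q) q r / qpoch q q a"
  let ?g = "\<lambda>j. q ^ (j choose 2) * (\<Prod>m<j. q ^ (r + e) + q ^ Suc a * q ^ m) / (qpoch q q j * qpoch (q ^ Suc a) q j)"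
  have c: "q ^ Suc a * q ^ m \<noteq> 1" for m
    using qq_neq_1[of "a + m"] by (simp add: power_add mult_ac)
  have shift': "?f (r + j) = ?C * ?g j" for j
  proof -
    have i: "int (r + j) - int r = int j" "int (r + j) + int r + int e = int (a + j)"
      by (auto simp: a_def)
    have P: "(\<Prod>m<j. q ^ (r + e) + q ^ Suc a * q ^ m) = (q ^ (r + e)) ^ j * qpoch (- q * q ^ r) q j"
    proof -
      have "Suc a = (r + e) + Suc r" by (simp add: a_def)
      then have "q ^ Suc a = q ^ (r + e) * (q * q ^ r)"
        by (simp only: power_add power_Suc)
      then show ?thesis
        using prod_factored[of "q ^ (r + e)" "q * q ^ r" q j] by (simp only: mult_minus_left)
    qed
    have "((r + j) choose 2) + e * (r + j) = ((r choose 2) + e * r) + ((j choose 2) + (r + e) * j)"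
      using choose_two_add[of r j] by (simp add: algebra_simps)
    then have p: "q ^ (((r + j) choose 2) + e * (r + j)) = q ^ ((r choose 2) + e * r) * (q ^ (j choose 2) * (q ^ (r + e)) ^ j)"
      by (simp only: power_add power_mult)
    show ?thesis
      unfolding i p P rqpoch_of_nat qpoch_qq_add qpoch_add[of "- q" q r j]
      by (simp add: divide_inverse mult_ac)
  qed
  have shift: "?f (j + r) = ?C * ?g j" for j
    using shift'[of j] unfolding add.commute[of r j] .
  have "?g sums (qpoch_inf (- (q ^ (r + e))) q / qpoch_inf (q ^ Suc a) q)"
    by (rule q_gauss_limit[OF norm_q_less_1 c])
  then have shifted: "(\<lambda>j. ?f (j + r)) sums (?C * (qpoch_inf (- (q ^ (r + e))) q / qpoch_inf (q ^ Suc a) q))"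
    unfolding shift by (rule sums_mult)
  have zero: "?f M = 0" if "M < r" for M using that by (simp add: rqpoch_neg)
  have "?f sums (?C * (qpoch_inf (- (q ^ (r + e))) q / qpoch_inf (q ^ Suc a) q))"
    by (rule sums_zero_iff_shift[THEN iffD1, OF zero shifted])
  moreover have "qpoch_inf q q = qpoch q q a * qpoch_inf (q ^ Suc a) q"
    using qpoch_inf_split[OF norm_q_less_1, of q a] by simp
  ultimately show ?thesis by (simp only: times_divide_times_eq mult.assoc)
qed

lemma rqpoch_sums_nat_0:
  "(\<lambda>M. q ^ (M choose 2) * qpoch (- q) q M * (rqpoch (int M - int r) * rqpoch (int M + int r)))
     sums (qpoch_inf (- q) q / qpoch_inf q q * (q ^ (r choose 2) * (1 + q ^ r)))"
proof -
  have "qpoch_inf (- (q ^ r)) q = (1 + q ^ r) * qpoch_inf (- q * q ^ r) q"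
    using qpoch_inf_split[OF norm_q_less_1, of "- (q ^ r)" 1] by (simp add: qpoch_Suc mult_ac)
  moreover have "qpoch_inf (- q) q = qpoch (- q) q r * qpoch_inf (- q * q ^ r) q"
    by (rule qpoch_inf_split[OF norm_q_less_1])
  ultimately show ?thesis
    using rqpoch_sums_nat[of 0 r] by (simp add: mult_ac)
qed

lemma rqpoch_sums_nat_1:
  "(\<lambda>M. q ^ ((M choose 2) + M) * qpoch (- q) q M * (rqpoch (int M - int r) * rqpoch (int M + int r + 1)))
     sums (qpoch_inf (- q) q / qpoch_inf q q * q ^ ((r choose 2) + r))"
proof -
  have "qpoch_inf (- q) q = qpoch (- q) q r * qpoch_inf (- q * q ^ r) q"
    by (rule qpoch_inf_split[OF norm_q_less_1])
  then show ?thesis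
    using rqpoch_sums_nat[of 1 r] by (simp add: mult_ac)
qed

lemma Q_choose_two:
  "Q (of_int (int r * (int r - 1)) / 2) = q ^ (r choose 2)"
  "Q (of_int (int r * (int r + 1)) / 2) = q ^ (r choose 2) * q ^ r"
proof -
  have "real r * real r = 2 * real (r choose 2) + real r"
    using two_choose_two[of r] by (metis of_nat_add of_nat_mult of_nat_numeral)
  then have "of_int (int r * (int r - 1)) / 2 = real (r choose 2)"
    "of_int (int r * (int r + 1)) / 2 = real ((r choose 2) + r)"
    by (simp_all add: algebra_simps)
  then show "Q (of_int (int r * (int r - 1)) / 2) = q ^ (r choose 2)"
    "Q (of_int (int r * (int r + 1)) / 2) = q ^ (r choose 2) * q ^ r"
    by (simp_all only: Q_of_nat power_add)
qed

text \<open>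
  The coefficient that the last, infinite summation of the Bailey chain attaches to \<open>c\<^sub>r\<close>, up to the
  factor \<open>(-q)\<^sub>\<infinity> / (q)\<^sub>\<infinity>\<close>: it is \<open>q\<^bsup>r(r-1)/2\<^esup> (1 + q\<^sup>r)\<close> for \<open>e = 0\<close> and \<open>q\<^bsup>r(r+1)/2\<^esup>\<close> for \<open>e = 1\<close>.
\<close>
definition limit_weight :: "nat \<Rightarrow> int \<Rightarrow> complex" where
  "limit_weight e r = Q (of_int (r * (r + 1)) / 2) + (if e = 0 then Q (of_int (r * (r - 1)) / 2) else 0)"

lemma limit_weight_0: "limit_weight 0 (int r) = q ^ (r choose 2) * (1 + q ^ r)"
  unfolding limit_weight_def Q_choose_two by (simp add: distrib_left)

lemma limit_weight_1: "limit_weight 1 (int r) = q ^ (r choose 2) * q ^ r"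
  unfolding limit_weight_def Q_choose_two by simp

lemma limit_weight_reflect:
  assumes "e \<le> 1"
  shows "limit_weight e (- int e - r) = limit_weight e r"
proof -
  have eqs: "(- int 0 - r) * ((- int 0 - r) + 1) = r * (r - 1)"
    "(- int 0 - r) * ((- int 0 - r) - 1) = r * (r + 1)"
    "(- int 1 - r) * ((- int 1 - r) + 1) = r * (r + 1)"
    by (simp_all add: algebra_simps)
  from assms consider "e = 0" | "e = 1" by linarith
  then show ?thesis
    by cases (simp_all only: limit_weight_def eqs, simp_all add: add.commute)
qed

lemma rqpoch_sums:
  assumes "e \<le> 1"
  shows "(\<lambda>M. q ^ ((M choose 2) + e * M) * qpoch (- q) q M * (rqpoch (int M - r) * rqpoch (int M + r + int e)))
     sums (qpoch_inf (- q) q / qpoch_inf q q * limit_weight e r)"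
proof -
  let ?f = "\<lambda>r M. q ^ ((M choose 2) + e * M) * qpoch (- q) q M * (rqpoch (int M - r) * rqpoch (int M + r + int e))"
  have *: "?f r sums (qpoch_inf (- q) q / qpoch_inf q q * limit_weight e r)" if r: "r \<ge> 0" for r
  proof -
    obtain n where n: "r = int n" using r by (rule nonneg_int_cases)
    from assms consider "e = 0" | "e = 1" by linarith
    then show ?thesis
    proof cases
      case 1
      then show ?thesis using rqpoch_sums_nat_0[of n] unfolding n
        by (simp add: limit_weight_0 distrib_left add.commute)
    next
      case 2
      then show ?thesis using rqpoch_sums_nat_1[of n] unfolding n
        by (simp add: limit_weight_1 [unfolded One_nat_def] power_add)
    qed
  qed
  show ?thesis
  proof (cases "r \<ge> 0")
    case False
    define s where "s = - int e - r"
    have s: "s \<ge> 0" using False assms by (simp add: s_def)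
    have "?f r = ?f s"
    proof
      fix M
      have "int M - s = int M + r + int e" "int M + s + int e = int M - r" by (auto simp: s_def)
      then show "?f r M = ?f s M" by (simp only: mult_ac)
    qed
    moreover have "limit_weight e r = limit_weight e s"
      using limit_weight_reflect[OF assms, of r] by (simp add: s_def)
    ultimately show ?thesis using *[OF s] by simp
  qed (rule *)
qed

lemma summable_norm_q_choose_two: "summable (\<lambda>M. norm q ^ (M choose 2))"
proof (rule summable_comparison_test')
  show "summable (\<lambda>M. norm q ^ M / norm q)"
    using norm_q_less_1 by (intro summable_divide summable_geometric) auto
  fix M
  have "M \<le> Suc (M choose 2)"
    by (induction M) (simp_all add: numeral_2_eq_2)
  then have "norm q ^ Suc (M choose 2) \<le> norm q ^ M"
    using norm_q_less_1 by (intro power_decreasing) auto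
  then show "norm (norm q ^ (M choose 2)) \<le> norm q ^ M / norm q"
    using q_nonzero by (simp add: field_simps)
qed

lemma bailey_sum_has_sum:
  "((\<lambda>r. c r * (rqpoch (int M - r) * rqpoch (int M + r + int e))) has_sum bailey_sum e c M) UNIV"
  unfolding bailey_sum_def
  by (rule has_sum_finite_neutralI[of "{- int M - int e..int M}"]) (auto simp: rqpoch_def)

text \<open>
  The infinite step of the Bailey chain. The interchange of the summations over \<open>M\<close> and \<open>r\<close> is
  justified by a majorant of the form \<open>f(M) g(r)\<close>.
\<close>
lemma bailey_limit:
  assumes c: "c summable_on UNIV" and e: "e \<le> 1"
  shows "((\<lambda>M. q ^ ((M choose 2) + e * M) * qpoch (- q) q M * bailey_sum e c M) has_sum
     (qpoch_inf (- q) q / qpoch_inf q q * (\<Sum>\<^sub>\<infinity>r. c r * limit_weight e r))) UNIV"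
proof -
  define K where "K = qpoch_inf (- q) q / qpoch_inf q q"
  define u where "u = (\<lambda>M. q ^ ((M choose 2) + e * M) * qpoch (- q) q M)"
  define v where "v = (\<lambda>M r. rqpoch (int M - r) * rqpoch (int M + r + int e))"
  define f where "f = (\<lambda>(M, r). u M * (c r * v M r))"
  obtain C1 where C1: "C1 > 0" "\<And>m. norm (rqpoch m) \<le> C1"
    using rqpoch_bounded by blast
  obtain C2 where C2: "C2 > 0" "\<And>n. norm (qpoch (- q) q n) \<le> C2"
    using qpoch_bounded[OF norm_q_less_1] by blast
  define g where "g = (\<lambda>(M, r). (norm q ^ (M choose 2) * C2) * (norm (c r) * (C1 * C1)))"
  have "(\<lambda>r. norm (c r) * (C1 * C1)) summable_on UNIV"
    using c by (intro summable_on_cmult_left) (simp add: summable_on_iff_abs_summable_on_complex)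
  then obtain S where S: "((\<lambda>r. norm (c r) * (C1 * C1)) has_sum S) UNIV"
    by (auto simp: summable_on_def)
  have "g summable_on UNIV \<times> UNIV"
  proof (rule summable_on_SigmaI)
    show "((\<lambda>r. g (M, r)) has_sum (norm q ^ (M choose 2) * C2) * S) UNIV" for M
      unfolding g_def using has_sum_cmult_right[OF S] by simp
    have "(\<lambda>M. norm q ^ (M choose 2)) summable_on UNIV"
      using summable_norm_q_choose_two by (subst summable_on_UNIV_nonneg_real_iff) auto
    then show "(\<lambda>M. norm q ^ (M choose 2) * C2 * S) summable_on UNIV"
      by (intro summable_on_cmult_left)
  qed (use C2 in \<open>auto simp: g_def\<close>)
  then have "(\<lambda>x. norm (f x)) summable_on UNIV \<times> UNIV"
  proof (rule Infinite_Sum.abs_summable_on_comparison_test')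
    fix x :: "nat \<times> int"
    obtain M r where x: "x = (M, r)" by force
    have "norm (u M) \<le> norm q ^ (M choose 2) * C2"
      unfolding u_def norm_mult norm_power using C2 norm_q_less_1
      by (intro mult_mono power_decreasing) auto
    moreover have "norm (c r * v M r) \<le> norm (c r) * (C1 * C1)"
      unfolding v_def norm_mult using C1 by (intro mult_left_mono mult_mono) auto
    ultimately show "norm (f x) \<le> g x"
      unfolding x f_def g_def prod.case norm_mult[of "u M"] using C2 by (intro mult_mono) auto
  qed
  then have f: "f summable_on UNIV \<times> UNIV" by (rule abs_summable_summable)
  then obtain T where T: "(f has_sum T) (UNIV \<times> UNIV)" by (auto simp: summable_on_def)
  have 1: "((\<lambda>M. u M * bailey_sum e c M) has_sum T) UNIV"
    using T by (rule has_sum_SigmaD)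
      (use bailey_sum_has_sum in \<open>auto simp: f_def v_def intro!: has_sum_cmult_right\<close>)
  have T': "((\<lambda>(r, M). f (M, r)) has_sum T) (UNIV \<times> UNIV)"
    using has_sum_reindex_bij_witness[of "UNIV \<times> UNIV" prod.swap prod.swap "UNIV \<times> UNIV"
        "\<lambda>(r, M). f (M, r)" f T T] T by auto
  have "((\<lambda>r. K * (c r * limit_weight e r)) has_sum T) UNIV"
    using T'
  proof (rule has_sum_SigmaD)
    fix r :: int
    have "(\<lambda>M. f (M, r)) summable_on UNIV"
      using T' summable_on_SigmaD1[of "\<lambda>r M. f (M, r)" UNIV "\<lambda>_. UNIV" r]
      by (auto simp: summable_on_def)
    then obtain R where R: "((\<lambda>M. f (M, r)) has_sum R) UNIV" by (auto simp: summable_on_def)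
    have "(\<lambda>M. f (M, r)) sums (c r * (K * limit_weight e r))"
      using sums_mult[OF rqpoch_sums[OF e, of r], of "c r"]
      by (simp add: f_def u_def v_def K_def mult_ac)
    with has_sum_imp_sums[OF R] have "R = c r * (K * limit_weight e r)"
      by (rule sums_unique2)
    with R show "((\<lambda>M. case (r, M) of (r, M) \<Rightarrow> f (M, r)) has_sum K * (c r * limit_weight e r)) UNIV"
      by (simp add: mult_ac)
  qed
  then have "T = K * (\<Sum>\<^sub>\<infinity>r. c r * limit_weight e r)"
    by (metis infsumI infsum_cmult_right')
  with 1 show ?thesis by (simp add: u_def K_def)
qed

end

section \<open>The quadratic form in terms of partial sums\<close>

text \<open>
  The partial sum \<open>M\<^sub>m = n\<^sub>m + \<dots> + n\<^bsub>k-1\<^esub> + (n\<^sub>k + n\<^bsub>k+1\<^esub>) / 2\<close>. The division is exact when \<open>n\<^sub>k\<close> and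
  \<open>n\<^bsub>k+1\<^esub>\<close> have the same parity.
\<close>
definition tail_sum :: "nat \<Rightarrow> nat \<Rightarrow> (nat \<Rightarrow> nat) \<Rightarrow> nat" where
  "tail_sum k m n = (\<Sum>j=m..k-1. n j) + (n k + n (k + 1)) div 2"

lemma of_nat_tail_sum:
  assumes "k \<ge> 1" "1 \<le> m" "m \<le> k" "[n k = n (k + 1)] (mod 2)"
  shows "real (tail_sum k m n) =
     (\<Sum>r=1..k+1. (if m \<le> r then 1 else 0) * ((if r < k then 1 else 1 / 2) * real (n r)))"
proof -
  have "even (n k + n (k + 1))"
    using assms(4) by (simp add: cong_def even_iff_mod_2_eq_zero) presburger
  then have half: "real ((n k + n (k + 1)) div 2) = (real (n k) + real (n (k + 1))) / 2"
    by (simp add: real_of_nat_div)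
  have "{1..k+1} = {1..k-1} \<union> {k, k+1}" using assms by auto
  then have "(\<Sum>r=1..k+1. (if m \<le> r then 1 else 0) * ((if r < k then 1 else 1 / 2) * real (n r)))
     = (\<Sum>r=1..k-1. (if m \<le> r then 1 else 0) * ((if r < k then 1 else 1 / 2) * real (n r)))
       + (real (n k) / 2 + real (n (k + 1)) / 2)"
    using assms by (subst \<open>{1..k+1} = _\<close>, subst sum.union_disjoint) auto
  also have "(\<Sum>r=1..k-1. (if m \<le> r then 1 else 0) * ((if r < k then 1 else 1 / 2) * real (n r)))
     = (\<Sum>r=m..k-1. real (n r))"
    using assms by (intro sum.mono_neutral_cong_right) auto
  finally show ?thesis by (simp only: tail_sum_def of_nat_add of_nat_sum half add_divide_distrib)
qed

lemma sum_of_bool_interval: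
  assumes "finite A" "{j\<in>A. P j} = {a<..b::nat}"
  shows "(\<Sum>j\<in>A. if P j then 1 else (0::real)) = real (b - a)"
proof -
  have "(\<Sum>j\<in>A. if P j then 1 else (0::real)) = real (card {j\<in>A. P j})"
    using assms(1) by (simp add: sum.If_cases Int_def)
  then show ?thesis using assms(2) by simp
qed

text \<open>
  The matrix as a combination of rank-one matrices, uniformly in \<open>k \<ge> 1\<close>: with weight \<open>1\<close> on the nodes
  below \<open>k\<close> and \<open>1/2\<close> on the last two, one matrix for every \<open>M\<^sub>j\<close>, and one for \<open>n\<^sub>k - n\<^bsub>k+1\<^esub>\<close>.
\<close>
lemma Ainv_decomposition:
  fixes k r s :: nat
  assumes "k \<ge> 1" "r \<in> {1..k+1}" "s \<in> {1..k+1}"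
    and u_def: "u = (\<lambda>r. if r < k then 1 else (1 / 2 :: real))"
    and v_def: "v = (\<lambda>r. if r = k then 1 else if r = k + 1 then -1 else (0 :: real))"
  shows "Ainv k r s = u r * u s
     + 2 * (\<Sum>j=2..k. ((if j \<le> r then 1 else 0) * u r) * ((if j \<le> s then 1 else 0) * u s))
     + v r * v s / 2"
proof -
  have "(\<Sum>j=2..k. ((if j \<le> r then 1 else 0) * u r) * ((if j \<le> s then 1 else 0) * u s))
     = u r * u s * (\<Sum>j=2..k. if j \<le> r \<and> j \<le> s then 1 else 0)"
    unfolding sum_distrib_left by (intro sum.cong) auto
  also have "(\<Sum>j=2..k. if j \<le> r \<and> j \<le> s then 1 else (0::real)) = real (min k (min r s) - 1)"
    by (rule sum_of_bool_interval) auto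
  finally have *: "(\<Sum>j=2..k. ((if j \<le> r then 1 else 0) * u r) * ((if j \<le> s then 1 else 0) * u s))
     = u r * u s * (real (min k (min r s)) - 1)"
    using assms(1-3) by (simp add: of_nat_diff)
  show ?thesis
    unfolding * using assms(1-3)
    by (auto simp: Ainv_def u_def v_def min_def field_simps)
qed

lemma quad_form_eq:
  assumes k: "k \<ge> 1" and par: "[n k = n (k + 1)] (mod 2)"
  shows "quad_form k n = (real (tail_sum k 1 n))\<^sup>2 + 2 * (\<Sum>j=2..k. (real (tail_sum k j n))\<^sup>2)
     + (real (n k) - real (n (k + 1)))\<^sup>2 / 2"
proof -
  define u where "u = (\<lambda>r. if r < k then 1 else (1 / 2 :: real))"
  define v where "v = (\<lambda>r. if r = k then 1 else if r = k + 1 then -1 else (0 :: real))"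
  let ?I = "{1..k+1}"
  let ?b = "\<lambda>j r. (if j \<le> r then 1 else 0) * (u r * real (n r))"
  have tot: "real (tail_sum k j n) = (\<Sum>r\<in>?I. ?b j r)" if "1 \<le> j" "j \<le> k" for j
    using of_nat_tail_sum[OF k that par] by (simp add: u_def)
  have v: "real (n k) - real (n (k + 1)) = (\<Sum>r\<in>?I. v r * real (n r))"
  proof -
    have "?I = {1..k-1} \<union> {k, k+1}" using k by auto
    moreover have "(\<Sum>r=1..k-1. v r * real (n r)) = 0"
      using k by (intro sum.neutral) (auto simp: v_def)
    ultimately show ?thesis
      using k by (simp add: sum.union_disjoint v_def)
  qed
  have "quad_form k n = (\<Sum>r\<in>?I. \<Sum>s\<in>?I. ?b 1 r * ?b 1 s
      + 2 * (\<Sum>j=2..k. ?b j r * ?b j s) + (v r * real (n r)) * (v s * real (n s)) / 2)"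
    unfolding quad_form_def
  proof (intro sum.cong refl)
    fix r s assume rs: "r \<in> ?I" "s \<in> ?I"
    define S where "S = (\<Sum>j=2..k. ((if j \<le> r then 1 else 0) * u r) * ((if j \<le> s then 1 else 0) * u s))"
    have S: "(\<Sum>j=2..k. ?b j r * ?b j s) = real (n r) * real (n s) * S"
      unfolding S_def sum_distrib_left by (intro sum.cong) auto
    have A: "Ainv k r s = u r * u s + 2 * S + v r * v s / 2"
      unfolding S_def by (rule Ainv_decomposition[OF k rs u_def v_def])
    show "real (n r) * Ainv k r s * real (n s) = ?b 1 r * ?b 1 s
      + 2 * (\<Sum>j=2..k. ?b j r * ?b j s) + (v r * real (n r)) * (v s * real (n s)) / 2"
      unfolding S A using rs by (simp add: algebra_simps)
  qed
  also have "\<dots> = (\<Sum>r\<in>?I. \<Sum>s\<in>?I. ?b 1 r * ?b 1 s)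
      + 2 * (\<Sum>j=2..k. \<Sum>r\<in>?I. \<Sum>s\<in>?I. ?b j r * ?b j s)
      + (\<Sum>r\<in>?I. \<Sum>s\<in>?I. (v r * real (n r)) * (v s * real (n s))) / 2"
  proof -
    have "(\<Sum>r\<in>?I. \<Sum>s\<in>?I. \<Sum>j=2..k. ?b j r * ?b j s) = (\<Sum>r\<in>?I. \<Sum>j=2..k. \<Sum>s\<in>?I. ?b j r * ?b j s)"
      by (intro sum.cong refl sum.swap)
    also have "\<dots> = (\<Sum>j=2..k. \<Sum>r\<in>?I. \<Sum>s\<in>?I. ?b j r * ?b j s)" by (rule sum.swap)
    finally show ?thesis
      by (simp only: sum.distrib sum_distrib_left[symmetric] sum_divide_distrib[symmetric])
  qed
  also have "\<dots> = (real (tail_sum k 1 n))\<^sup>2 + 2 * (\<Sum>j=2..k. (real (tail_sum k j n))\<^sup>2)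
     + (real (n k) - real (n (k + 1)))\<^sup>2 / 2"
  proof -
    have sq: "(\<Sum>r\<in>?I. \<Sum>s\<in>?I. f r * f s) = (sum f ?I)\<^sup>2" for f :: "nat \<Rightarrow> real"
      by (simp only: power2_eq_square sum_product)
    have "(\<Sum>j=2..k. (real (tail_sum k j n))\<^sup>2) = (\<Sum>j=2..k. (\<Sum>r\<in>?I. ?b j r)\<^sup>2)"
      by (intro sum.cong refl) (subst tot, auto)
    moreover have "real (tail_sum k 1 n) = (\<Sum>r\<in>?I. ?b 1 r)" using k by (intro tot) auto
    ultimately show ?thesis by (simp only: sq v)
  qed
  finally show ?thesis .
qed

lemma lambda_lin_eq:
  assumes k: "k \<ge> 1" and i: "i \<le> k" and par: "[n k = n (k + 1)] (mod 2)"
  shows "lambda_lin k i n = - (1 / 2) * real (tail_sum k 1 n)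
    + (\<Sum>j=1..k. if k < i + j then real (tail_sum k j n) else 0)"
proof -
  define u where "u = (\<lambda>r. if r < k then 1 else (1 / 2 :: real))"
  let ?I = "{1..k+1}"
  have tot: "real (tail_sum k j n) = (\<Sum>r\<in>?I. (if j \<le> r then 1 else 0) * (u r * real (n r)))" if "1 \<le> j" "j \<le> k" for j
    using of_nat_tail_sum[OF k that par] by (simp add: u_def)
  let ?w = "\<lambda>r. u r * real (n r) * (real (min k r - (k - i)) - 1 / 2)"
  have "(\<Sum>j=1..k. if k < i + j then real (tail_sum k j n) else 0)
      = (\<Sum>j=1..k. \<Sum>r\<in>?I. (if k < i + j \<and> j \<le> r then 1 else 0) * (u r * real (n r)))"
    by (intro sum.cong refl) (auto simp: tot)
  also have "\<dots> = (\<Sum>r\<in>?I. (\<Sum>j=1..k. (if k < i + j \<and> j \<le> r then 1 else 0)) * (u r * real (n r)))"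
    by (subst sum.swap) (simp only: sum_distrib_right)
  also have "\<dots> = (\<Sum>r\<in>?I. real (min k r - (k - i)) * (u r * real (n r)))"
    using i by (intro sum.cong refl arg_cong2[of _ _ _ _ "(*)"] sum_of_bool_interval) auto
  finally have A: "(\<Sum>j=1..k. if k < i + j then real (tail_sum k j n) else 0)
     = (\<Sum>r\<in>?I. real (min k r - (k - i)) * (u r * real (n r)))" .
  have B: "real (tail_sum k 1 n) = (\<Sum>r\<in>?I. u r * real (n r))"
    using tot[of 1] k by (auto intro!: sum.cong)
  have "- (1 / 2) * real (tail_sum k 1 n) + (\<Sum>j=1..k. if k < i + j then real (tail_sum k j n) else 0)
     = (\<Sum>r\<in>?I. ?w r)"
    unfolding A B sum_distrib_left sum.distrib[symmetric] by (intro sum.cong) (auto simp: algebra_simps)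
  also have "\<dots> = (\<Sum>r=1..k-1. ?w r) + (?w k + ?w (k + 1))"
  proof -
    have "?I = {1..k-1} \<union> {k, k+1}" using k by auto
    then show ?thesis using k by (simp add: sum.union_disjoint)
  qed
  also have "?w k + ?w (k + 1) = (2 * real i - 1) / 4 * (real (n k) + real (n (k + 1)))"
    using i by (simp add: u_def field_simps)
  also have "(\<Sum>r=1..k-1. ?w r) = (\<Sum>r=1..min (k - i) (k - 1). ?w r) + (\<Sum>r=k-i+1..k-1. ?w r)"
  proof -
    have "{1..k-1} = {1..min (k - i) (k - 1)} \<union> {k-i+1..k-1}" by auto
    then show ?thesis by (simp only:) (rule sum.union_disjoint, auto)
  qed
  also have "(\<Sum>r=1..min (k - i) (k - 1). ?w r) = - (1 / 2) * (\<Sum>j=1..min (k - i) (k - 1). real (n j))"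
    unfolding sum_distrib_left using k by (intro sum.cong refl) (auto simp: u_def)
  also have "(\<Sum>r=k-i+1..k-1. ?w r) = (\<Sum>j=k-i+1..k-1. (2 * (real j - real k + real i) - 1) / 2 * real (n j))"
    using k i by (intro sum.cong refl) (auto simp: u_def of_nat_diff field_simps)
  finally show ?thesis by (simp add: lambda_lin_def)
qed

section \<open>Summation over tuples with a prescribed partial sum\<close>

text \<open>
  The tuples \<open>(n\<^sub>m, \<dots>, n\<^bsub>k+1\<^esub>)\<close> that satisfy the parity condition and have \<open>M\<^sub>m = L\<close>, as extensional
  functions.
\<close>
definition tail_tuples :: "nat \<Rightarrow> nat \<Rightarrow> nat \<Rightarrow> (nat \<Rightarrow> nat) set" where
  "tail_tuples k m L = {n \<in> {m..k+1} \<rightarrow>\<^sub>E UNIV. [n k = n (k + 1)] (mod 2) \<and> tail_sum k m n = L}"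

lemma entry_le_tail_sum:
  assumes "j \<in> {m..k+1}"
  shows "n j \<le> Suc (2 * tail_sum k m n)"
proof -
  consider "j \<in> {m..k-1}" | "j = k" | "j = k + 1" using assms by fastforce
  then show ?thesis
  proof cases
    case 1
    then have "n j \<le> (\<Sum>j=m..k-1. n j)" by (intro member_le_sum) auto
    then show ?thesis by (simp add: tail_sum_def)
  qed (simp_all add: tail_sum_def; presburger)+
qed

lemma finite_tail_tuples: "finite (tail_tuples k m L)"
proof (rule finite_subset)
  show "tail_tuples k m L \<subseteq> {m..k+1} \<rightarrow>\<^sub>E {..Suc (2 * L)}"
  proof
    fix n assume n: "n \<in> tail_tuples k m L"
    then have "n j \<le> Suc (2 * L)" if "j \<in> {m..k+1}" for j
      using entry_le_tail_sum[OF that, of n] by (simp add: tail_tuples_def)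
    with n show "n \<in> {m..k+1} \<rightarrow>\<^sub>E {..Suc (2 * L)}"
      by (simp add: tail_tuples_def PiE_iff)
  qed
qed (auto intro: finite_PiE)

lemma tail_sum_rec: "m < k \<Longrightarrow> tail_sum k m n = n m + tail_sum k (Suc m) n"
  by (simp add: tail_sum_def sum.atLeast_Suc_atMost)

lemma tail_sum_cong:
  assumes "\<And>j. j \<in> {m..k+1} \<Longrightarrow> n j = n' j" "m \<le> k"
  shows "tail_sum k m n = tail_sum k m n'"
proof -
  have "(\<Sum>j=m..k-1. n j) = (\<Sum>j=m..k-1. n' j)" by (intro sum.cong refl assms) auto
  then show ?thesis using assms by (simp add: tail_sum_def)
qed

context nome
begin

text \<open>
  The product of \<open>q\<^bsup>D\<^sup>2\<^esup>\<close>, of the factors \<open>q\<^bsup>M\<^sub>j\<^sup>2\<^esup>\<close> or \<open>q\<^bsup>M\<^sub>j\<^sup>2 + M\<^sub>j\<^esup>\<close> for \<open>m < j \<le> k\<close>, and of the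
  reciprocals of \<open>(q)\<^bsub>n\<^sub>m\<^esub>, \<dots>, (q)\<^bsub>n\<^bsub>k+1\<^esub>\<^esub>\<close>, where \<open>D = (n\<^sub>k - n\<^bsub>k+1\<^esub>) / 2\<close>. The condition \<open>k < i + j\<close>
  selects the indices \<open>j\<close> with a linear term \<open>M\<^sub>j\<close>.
\<close>
definition tail_weight :: "nat \<Rightarrow> nat \<Rightarrow> nat \<Rightarrow> (nat \<Rightarrow> nat) \<Rightarrow> complex" where
  "tail_weight k i m n =
     Q ((\<Sum>j=Suc m..k. (real (tail_sum k j n))\<^sup>2 + (if k < i + j then real (tail_sum k j n) else 0))
         + ((real (n k) - real (n (k + 1))) / 2)\<^sup>2)
     / (\<Prod>j=m..k+1. qpoch q q (n j))"

text \<open>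
  The sequence reached by the Bailey chain after the summations over \<open>M\<^sub>k, \<dots>, M\<^bsub>m+1\<^esub>\<close>, of which the
  first \<open>min i (k - m)\<close> contain a linear term.
\<close>
definition theta_seq :: "nat \<Rightarrow> nat \<Rightarrow> nat \<Rightarrow> int \<Rightarrow> complex" where
  "theta_seq k i m r =
     (2 * of_int r + 1) * Q (real (Suc (k - m)) * of_int (r\<^sup>2) + real (min i (k - m)) * of_int r)"

lemma theta_seq_antisym:
  assumes "k - m \<le> i"
  shows "Q (of_int (- 1 - r)) * theta_seq k i m (- 1 - r) = - (Q (of_int r) * theta_seq k i m r)"
proof -
  define d where "d = real (k - m)"
  have "of_int (- 1 - r) + (real (Suc (k - m)) * of_int ((- 1 - r)\<^sup>2) + real (k - m) * of_int (- 1 - r))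
     = of_int r + (real (Suc (k - m)) * of_int (r\<^sup>2) + real (k - m) * of_int r)"
    by (simp add: d_def[symmetric] power2_eq_square algebra_simps)
  then have "Q (of_int (- 1 - r)) * Q (real (Suc (k - m)) * of_int ((- 1 - r)\<^sup>2) + real (k - m) * of_int (- 1 - r))
    = Q (of_int r) * Q (real (Suc (k - m)) * of_int (r\<^sup>2) + real (k - m) * of_int r)"
    by (simp only: Q_add[symmetric])
  moreover have "2 * of_int (- 1 - r) + 1 = - (2 * of_int r + 1 :: complex)" by simp
  moreover have "A * (- c * X) = - (B * (c * Y))" if "A * X = B * Y" for A B X Y c :: complex
    using that by algebra
  ultimately show ?thesis
    unfolding theta_seq_def min_absorb2[OF assms] by (simp only:)
qed

text \<open>
  The start of the chain: with \<open>n\<^sub>k = L + r\<close> and \<open>n\<^bsub>k+1\<^esub> = L - r\<close> the sum is that of \<open>q\<^bsup>r\<^sup>2\<^esup>\<close>, and the terms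
  with the factor \<open>2 r\<close> that turn it into that of \<open>(2 r + 1) q\<^bsup>r\<^sup>2\<^esup>\<close> cancel in pairs \<open>r, - r\<close>.
\<close>
lemma sum_tail_tuples_base:
  assumes k: "k \<ge> 1"
  shows "(\<Sum>n\<in>tail_tuples k k L. tail_weight k i k n) = bailey_sum 0 (theta_seq k i k) L"
proof -
  let ?A = "{- int L..int L}"
  let ?h = "\<lambda>r. Q (of_int (r\<^sup>2)) * (rqpoch (int L - r) * rqpoch (int L + r))"
  let ?n = "\<lambda>r. restrict (\<lambda>j. if j = k then nat (int L + r) else nat (int L - r)) {k..k+1}"
  have tot: "tail_sum k k n = (n k + n (k + 1)) div 2" for n
    using k by (simp add: tail_sum_def)
  have "(\<Sum>n\<in>tail_tuples k k L. tail_weight k i k n) = (\<Sum>r\<in>?A. ?h r)"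
  proof (rule sum.reindex_bij_witness[of _ ?n "\<lambda>n. (int (n k) - int (n (k + 1))) div 2"])
    fix n assume n: "n \<in> tail_tuples k k L"
    let ?r = "(int (n k) - int (n (k + 1))) div 2"
    have ext: "n \<in> {k..k+1} \<rightarrow>\<^sub>E UNIV" using n by (simp add: tail_tuples_def)
    have "n k mod 2 = n (k + 1) mod 2" "(n k + n (k + 1)) div 2 = L"
      using n unfolding tail_tuples_def tot cong_def by blast+
    then have "n k + n (k + 1) = 2 * L" by presburger
    then have x1: "int (n k) + int (n (k + 1)) = 2 * int L"
      by (metis of_nat_add of_nat_mult of_nat_numeral)
    define r where "r = ?r"
    have "int (n k) - int (n (k + 1)) = 2 * (int L - int (n (k + 1)))"
      using x1 by simp
    then have r: "r = int L - int (n (k + 1))" by (simp add: r_def)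
    have x: "int (n k) = int L + r" and y: "int (n (k + 1)) = int L - r"
      using x1 r by simp_all
    have xy': "nat (int L + r) = n k" "nat (int L - r) = n (k + 1)"
      unfolding x[symmetric] y[symmetric] by simp_all
    have "?n r = n"
    proof
      fix j
      consider "j = k" | "j = k + 1" | "j \<notin> {k..k+1}" by fastforce
      then show "?n r j = n j"
        using PiE_arb[OF ext] unfolding xy' by cases auto
    qed
    then show "?n ?r = n" by (simp only: r_def)
    have "r \<in> ?A" using x y by simp
    then show "?r \<in> ?A" by (simp only: r_def)
    have "real (n k) - real (n (k + 1)) = real_of_int (int (n k)) - real_of_int (int (n (k + 1)))"
      by simp
    also have "\<dots> = 2 * real_of_int r" unfolding x y by simp
    finally have d: "((real (n k) - real (n (k + 1))) / 2)\<^sup>2 = of_int (r\<^sup>2)" by simp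
    have kk: "{k..k+1} = {k, k+1}" by auto
    have "tail_weight k i k n = Q (of_int (r\<^sup>2)) / (qpoch q q (n k) * qpoch q q (n (k + 1)))"
      unfolding tail_weight_def d kk by simp
    also have "\<dots> = ?h r"
      unfolding x[symmetric] y[symmetric] rqpoch_of_nat by simp
    finally show "?h ?r = tail_weight k i k n" by (simp only: r_def)
  next
    fix r assume r: "r \<in> ?A"
    then show "(int (?n r k) - int (?n r (k + 1))) div 2 = r" by simp
    define x y where "x = nat (int L + r)" and "y = nat (int L - r)"
    have "x + y = 2 * L" using r unfolding x_def y_def atLeastAtMost_iff by linarith
    then have "x mod 2 = y mod 2" "(x + y) div 2 = L" by presburger+
    then have "[nat (int L + r) = nat (int L - r)] (mod 2)" "(nat (int L + r) + nat (int L - r)) div 2 = L"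
      by (simp_all only: cong_def x_def y_def)
    then show "?n r \<in> tail_tuples k k L" by (simp add: tail_tuples_def tot)
  qed
  also have "\<dots> = bailey_sum 0 (theta_seq k i k) L"
  proof -
    have "(\<Sum>r\<in>?A. of_int r * ?h r) = (\<Sum>r\<in>?A. - (of_int r * ?h r))"
      by (rule sum.reindex_bij_witness[of _ uminus uminus]) auto
    then have zero: "(\<Sum>r\<in>?A. of_int r * ?h r) = 0" by (simp add: sum_negf)
    have "bailey_sum 0 (theta_seq k i k) L = (\<Sum>r\<in>?A. 2 * (of_int r * ?h r) + ?h r)"
      unfolding bailey_sum_def theta_seq_def by (intro sum.cong) (auto simp: algebra_simps)
    also have "\<dots> = 2 * (\<Sum>r\<in>?A. of_int r * ?h r) + (\<Sum>r\<in>?A. ?h r)"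
      by (simp only: sum.distrib sum_distrib_left)
    finally show ?thesis using zero by simp
  qed
  finally show ?thesis .
qed

text \<open>A tuple with \<open>M\<^sub>m = L\<close> amounts to a shorter one with \<open>M\<^bsub>m+1\<^esub> = M \<le> L\<close>, and \<open>n\<^sub>m = L - M\<close>.\<close>
lemma sum_tail_tuples_step:
  assumes m: "m < k"
  shows "(\<Sum>n\<in>tail_tuples k m L. tail_weight k i m n)
    = (\<Sum>M\<le>L. q ^ (M * M + (if k < i + Suc m then 1 else 0) * M) * rqpoch (int L - int M)
         * (\<Sum>n\<in>tail_tuples k (Suc m) M. tail_weight k i (Suc m) n))"
proof -
  let ?e = "if k < i + Suc m then 1 else 0 :: nat"
  let ?F = "\<lambda>(M, n). q ^ (M * M + ?e * M) * rqpoch (int L - int M) * tail_weight k i (Suc m) n"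
  have "(\<Sum>n\<in>tail_tuples k m L. tail_weight k i m n) = sum ?F (Sigma {..L} (tail_tuples k (Suc m)))"
  proof (rule sum.reindex_bij_witness[of _ "\<lambda>(M, n). n(m := L - M)" "\<lambda>n. (tail_sum k (Suc m) n, restrict n {Suc m..k+1})"])
    fix n assume n: "n \<in> tail_tuples k m L"
    let ?n' = "restrict n {Suc m..k+1}"
    have ext: "n \<in> {m..k+1} \<rightarrow>\<^sub>E UNIV" and par: "[n k = n (k + 1)] (mod 2)" and L: "n m + tail_sum k (Suc m) n = L"
      using n tail_sum_rec[OF m, of n] by (auto simp: tail_tuples_def)
    have tot: "tail_sum k j ?n' = tail_sum k j n" if "Suc m \<le> j" "j \<le> k" for j
      using that by (intro tail_sum_cong) auto
    show "(case (tail_sum k (Suc m) n, ?n') of (M, n) \<Rightarrow> n(m := L - M)) = n"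
    proof
      fix j
      have "j = m \<or> j \<in> {Suc m..k+1} \<or> j \<notin> {m..k+1}" by auto
      then show "(case (tail_sum k (Suc m) n, ?n') of (M, n) \<Rightarrow> n(m := L - M)) j = n j"
        using L PiE_arb[OF ext] by auto
    qed
    show "(tail_sum k (Suc m) n, ?n') \<in> Sigma {..L} (tail_tuples k (Suc m))"
      using L par tot[of "Suc m"] m by (auto simp: tail_tuples_def)
    show "?F (tail_sum k (Suc m) n, ?n') = tail_weight k i m n"
    proof -
      let ?M = "tail_sum k (Suc m) n"
      let ?t = "\<lambda>n j. (real (tail_sum k j n))\<^sup>2 + (if k < i + j then real (tail_sum k j n) else 0)"
      let ?D = "((real (n k) - real (n (k + 1))) / 2)\<^sup>2"
      have "(\<Sum>j=Suc m..k. ?t n j) = ?t n (Suc m) + (\<Sum>j=Suc (Suc m)..k. ?t n j)"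
        using m by (simp add: sum.atLeast_Suc_atMost)
      also have "?t n (Suc m) = real (?M * ?M + ?e * ?M)"
        by (simp add: power2_eq_square)
      also have "(\<Sum>j=Suc (Suc m)..k. ?t n j) = (\<Sum>j=Suc (Suc m)..k. ?t ?n' j)"
      proof (intro sum.cong refl)
        fix j assume "j \<in> {Suc (Suc m)..k}"
        then have "tail_sum k j ?n' = tail_sum k j n" by (intro tot) auto
        then show "?t n j = ?t ?n' j" by (simp only:)
      qed
      finally have "Q ((\<Sum>j=Suc m..k. ?t n j) + ?D)
         = q ^ (?M * ?M + ?e * ?M) * Q ((\<Sum>j=Suc (Suc m)..k. ?t ?n' j) + ?D)"
        by (simp only: Q_add Q_of_nat mult.assoc)
      moreover have "(\<Prod>j=m..k+1. qpoch q q (n j)) = qpoch q q (n m) * (\<Prod>j=Suc m..k+1. qpoch q q (n j))"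
        using m by (simp add: prod.atLeast_Suc_atMost)
      moreover have "(\<Prod>j=Suc m..k+1. qpoch q q (n j)) = (\<Prod>j=Suc m..k+1. qpoch q q (?n' j))"
        by (intro prod.cong) auto
      moreover have "int L - int ?M = int (n m)" using L by simp
      moreover have "?n' k = n k" "?n' (k + 1) = n (k + 1)" using m by auto
      ultimately show ?thesis
        unfolding tail_weight_def prod.case by (simp only: rqpoch_of_nat) simp
    qed
  next
    fix x assume "x \<in> Sigma {..L} (tail_tuples k (Suc m))"
    then obtain M n where x: "x = (M, n)" "M \<le> L" and n: "n \<in> tail_tuples k (Suc m) M" by auto
    have ext: "n \<in> {Suc m..k+1} \<rightarrow>\<^sub>E UNIV" and par: "[n k = n (k + 1)] (mod 2)" and M: "tail_sum k (Suc m) n = M"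
      using n by (auto simp: tail_tuples_def)
    have tot: "tail_sum k (Suc m) (n(m := L - M)) = M"
      unfolding M[symmetric] using m by (intro tail_sum_cong) auto
    have "restrict (n(m := L - M)) {Suc m..k+1} = n"
    proof
      fix j show "restrict (n(m := L - M)) {Suc m..k+1} j = n j"
        using PiE_arb[OF ext] by (auto simp: restrict_def)
    qed
    then show "(tail_sum k (Suc m) (case x of (M, n) \<Rightarrow> n(m := L - M)),
        restrict (case x of (M, n) \<Rightarrow> n(m := L - M)) {Suc m..k+1}) = x"
      by (simp add: x tot)
    have "n(m := L - M) \<in> {m..k+1} \<rightarrow>\<^sub>E UNIV"
      using ext m by (auto simp: PiE_iff extensional_def)
    then show "(case x of (M, n) \<Rightarrow> n(m := L - M)) \<in> tail_tuples k m L"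
      using par m x(2) by (simp add: x tail_tuples_def tail_sum_rec[OF m] tot)
  qed
  also have "\<dots> = (\<Sum>M\<le>L. \<Sum>n\<in>tail_tuples k (Suc m) M. ?F (M, n))"
    by (subst sum.Sigma) (auto simp: finite_tail_tuples)
  finally show ?thesis by (simp only: prod.case sum_distrib_left)
qed

lemma sum_tail_tuples:
  assumes "k \<ge> 1" "m \<le> k"
  shows "(\<Sum>n\<in>tail_tuples k m L. tail_weight k i m n) = bailey_sum 0 (theta_seq k i m) L"
  using assms(2)
proof (induction arbitrary: L rule: inc_induct)
  case base
  show ?case by (rule sum_tail_tuples_base[OF assms(1)])
next
  case (step m L)
  have d: "k - m = Suc (k - Suc m)" using step.hyps by simp
  show ?case
  proof (cases "k < i + Suc m")
    \<comment> \<open>The step has a linear term: it is carried out with \<open>e = 1\<close>.\<close>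
    case True
    then have mins: "min i (k - Suc m) = k - Suc m" "min i (k - m) = k - m" by auto
    have seq: "theta_seq k i m = (\<lambda>r. Q (of_int (r * r + int 1 * r)) * theta_seq k i (Suc m) r)"
    proof
      fix r
      have "real (Suc (k - m)) * of_int (r\<^sup>2) + real (k - m) * of_int r
        = of_int (r * r + int 1 * r) + (real (Suc (k - Suc m)) * of_int (r\<^sup>2) + real (k - Suc m) * of_int r)"
        by (simp add: d power2_eq_square algebra_simps)
      then have "Q (real (Suc (k - m)) * of_int (r\<^sup>2) + real (k - m) * of_int r)
        = Q (of_int (r * r + int 1 * r)) * Q (real (Suc (k - Suc m)) * of_int (r\<^sup>2) + real (k - Suc m) * of_int r)"
        by (simp only: Q_add)
      then show "theta_seq k i m r = Q (of_int (r * r + int 1 * r)) * theta_seq k i (Suc m) r"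
        unfolding theta_seq_def mins by (simp only: mult_ac)
    qed
    have "(\<Sum>n\<in>tail_tuples k m L. tail_weight k i m n)
      = (\<Sum>M\<le>L. q ^ (M * M + 1 * M) * rqpoch (int L - int M) * bailey_sum 1 (theta_seq k i (Suc m)) M)"
      using True by (simp add: sum_tail_tuples_step[OF step.hyps(2)] step.IH
        bailey_sum_change_parameter[OF theta_seq_antisym])
    also have "\<dots> = bailey_sum 1 (theta_seq k i m) L"
      unfolding seq by (rule bailey_step) simp
    also have "\<dots> = bailey_sum 0 (theta_seq k i m) L"
      using True by (intro bailey_sum_change_parameter[symmetric] theta_seq_antisym) simp
    finally show ?thesis .
  next
    case False
    then have mins: "min i (k - Suc m) = i" "min i (k - m) = i" by auto
    have seq: "theta_seq k i m = (\<lambda>r. Q (of_int (r * r + int 0 * r)) * theta_seq k i (Suc m) r)"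
    proof
      fix r
      have "real (Suc (k - m)) * of_int (r\<^sup>2) + real i * of_int r
        = of_int (r * r + int 0 * r) + (real (Suc (k - Suc m)) * of_int (r\<^sup>2) + real i * of_int r)"
        by (simp add: d power2_eq_square algebra_simps)
      then have "Q (real (Suc (k - m)) * of_int (r\<^sup>2) + real i * of_int r)
        = Q (of_int (r * r + int 0 * r)) * Q (real (Suc (k - Suc m)) * of_int (r\<^sup>2) + real i * of_int r)"
        by (simp only: Q_add)
      then show "theta_seq k i m r = Q (of_int (r * r + int 0 * r)) * theta_seq k i (Suc m) r"
        unfolding theta_seq_def mins by (simp only: mult_ac)
    qed
    have "(\<Sum>n\<in>tail_tuples k m L. tail_weight k i m n)
      = (\<Sum>M\<le>L. q ^ (M * M + 0 * M) * rqpoch (int L - int M) * bailey_sum 0 (theta_seq k i (Suc m)) M)"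
      using False by (simp add: sum_tail_tuples_step[OF step.hyps(2)] step.IH)
    also have "\<dots> = bailey_sum 0 (theta_seq k i m) L"
      unfolding seq by (rule bailey_step) simp
    finally show ?thesis .
  qed
qed

end

section \<open>Convergence\<close>

lemma summable_on_int_if_nat:
  fixes f :: "nat \<Rightarrow> real"
  assumes "f summable_on UNIV"
  shows "(\<lambda>r::int. f (nat \<bar>r\<bar>)) summable_on UNIV"
proof -
  have "(\<lambda>r::int. f (nat \<bar>r\<bar>)) summable_on range int"
    by (subst summable_on_reindex) (auto simp: o_def assms)
  moreover have "(\<lambda>r::int. f (nat \<bar>r\<bar>)) summable_on range (\<lambda>n. - int n)"
    by (subst summable_on_reindex) (auto simp: o_def assms inj_on_def)
  ultimately have "(\<lambda>r::int. f (nat \<bar>r\<bar>)) summable_on range int \<union> range (\<lambda>n. - int n)"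
    by (rule summable_on_union)
  moreover have "range int \<union> range (\<lambda>n. - int n) = UNIV"
    by (auto intro: int_cases2)
  ultimately show ?thesis by simp
qed

context nome
begin

text \<open>Under the hypotheses, the exponent is at least \<open>\<bar>r\<bar> - 1\<close>, because \<open>(\<bar>r\<bar> - 1) (\<bar>r\<bar> - 2) \<ge> 0\<close>.\<close>
lemma summable_theta:
  fixes a b :: real
  assumes a: "a \<ge> 1 / 2" and b: "\<bar>b\<bar> \<le> a"
  shows "(\<lambda>r::int. (2 * of_int r + 1) * Q (a * of_int (r\<^sup>2) + b * of_int r)) summable_on UNIV"
proof (rule abs_summable_summable, rule Infinite_Sum.abs_summable_on_comparison_test')
  let ?f = "\<lambda>n. 2 * (real (Suc n) * norm q ^ n) / norm q"
  have "summable ?f"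
    using geometric_deriv_sums[of "norm q"] norm_q_less_1
    by (intro summable_divide summable_mult) (auto simp: sums_iff)
  then show "(\<lambda>r::int. ?f (nat \<bar>r\<bar>)) summable_on UNIV"
    by (intro summable_on_int_if_nat) (subst summable_on_UNIV_nonneg_real_iff, auto)
  fix r :: int
  define n where "n = nat \<bar>r\<bar>"
  have n: "real n = \<bar>of_int r\<bar>" by (simp add: n_def)
  have "(int n - 1) * (int n - 2) \<ge> 0"
    by (cases "n \<le> 1") (auto simp: mult_nonneg_nonneg mult_nonpos_nonpos)
  then have "real_of_int ((int n - 1) * (int n - 2)) \<ge> 0" by (simp only: of_int_0_le_iff)
  then have *: "2 * real n - 2 \<le> (real n)\<^sup>2 - real n"
    by (simp add: power2_eq_square algebra_simps)
  have "(real n)\<^sup>2 - real n \<ge> 0"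
    by (cases n) (simp_all add: power2_eq_square algebra_simps)
  with a have "1 / 2 * ((real n)\<^sup>2 - real n) \<le> a * ((real n)\<^sup>2 - real n)"
    by (intro mult_right_mono)
  moreover have "\<bar>b * of_int r\<bar> \<le> a * real n"
    unfolding abs_mult n using b by (intro mult_right_mono) auto
  moreover have "of_int (r\<^sup>2) = (real n)\<^sup>2" by (simp add: n)
  ultimately have exponent: "real n - 1 \<le> a * of_int (r\<^sup>2) + b * of_int r"
    using * by (simp add: algebra_simps)
  have "norm (Q (a * of_int (r\<^sup>2) + b * of_int r)) \<le> norm (Q (real n - 1))"
    using exponent by (rule norm_Q_antimono)
  also have "\<dots> = norm q ^ n / norm q"
  proof -
    have "q ^ n = Q (real n - 1) * q"
      using Q_add[of "real n - 1" 1] by (simp add: Q_of_nat q_eq[symmetric])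
    then have "norm q ^ n = norm (Q (real n - 1)) * norm q"
      by (simp only: norm_power[symmetric] norm_mult[symmetric])
    then show ?thesis using q_nonzero by simp
  qed
  finally have 1: "norm (Q (a * of_int (r\<^sup>2) + b * of_int r)) \<le> norm q ^ n / norm q" .
  have "2 * of_int r + 1 = complex_of_real (2 * of_int r + 1)" by simp
  then have "norm (2 * of_int r + 1 :: complex) = \<bar>2 * of_int r + 1\<bar>"
    by (simp only: norm_of_real)
  also have "\<dots> \<le> 2 * real (Suc n)" using n by simp
  finally have 2: "norm (2 * of_int r + 1 :: complex) \<le> 2 * real (Suc n)" .
  show "norm ((2 * of_int r + 1) * Q (a * of_int (r\<^sup>2) + b * of_int r)) \<le> ?f (nat \<bar>r\<bar>)"
  proof -
    have "?f n = 2 * real (Suc n) * (norm q ^ n / norm q)"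
      by (simp only: times_divide_eq_right mult.assoc)
    then show ?thesis
      unfolding norm_mult n_def[symmetric] by (simp only:) (intro mult_mono 1 2, auto)
  qed
qed

lemma nahm_term_eq:
  assumes k: "k \<ge> 1" and i: "i \<le> k" and n: "n \<in> tail_tuples k 1 L"
  shows "nahm_term k i \<tau> n =
     q ^ ((L choose 2) + (if i = k then 1 else 0) * L) * qpoch (- q) q L * tail_weight k i 1 n"
proof -
  have par: "[n k = n (k + 1)] (mod 2)" and L: "tail_sum k 1 n = L"
    using n by (auto simp: tail_tuples_def)
  let ?t = "\<lambda>j. real (tail_sum k j n)"
  let ?d = "\<lambda>j. if k < i + j then ?t j else 0"
  have Lt: "(\<Sum>j=1..k-1. n j) + (n k + n (k + 1)) div 2 = L"
    using L by (simp add: tail_sum_def)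
  have head: "(\<Sum>j=1..k. ?d j) = (if i = k then 1 else 0) * real L + (\<Sum>j=Suc 1..k. ?d j)"
    using k i L by (auto simp: sum.atLeast_Suc_atMost)
  have sq: "(real L)\<^sup>2 = 2 * real (L choose 2) + real L"
    using two_choose_two[of L] by (metis of_nat_add of_nat_mult of_nat_numeral power2_eq_square)
  have "quad_form k n / 2 + lambda_lin k i n
     = real ((L choose 2) + (if i = k then 1 else 0) * L)
       + ((\<Sum>j=Suc 1..k. (?t j)\<^sup>2 + ?d j) + ((real (n k) - real (n (k + 1))) / 2)\<^sup>2)"
    unfolding quad_form_eq[OF k par] lambda_lin_eq[OF k i par] head L sq sum.distrib
    by (simp add: power_divide field_simps flip: numeral_2_eq_2)
  then have "Q (quad_form k n / 2 + lambda_lin k i n) = q ^ ((L choose 2) + (if i = k then 1 else 0) * L)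
     * Q ((\<Sum>j=Suc 1..k. (?t j)\<^sup>2 + ?d j) + ((real (n k) - real (n (k + 1))) / 2)\<^sup>2)"
    by (simp only: Q_add Q_of_nat)
  then show ?thesis
    unfolding nahm_term_def Let_def Lt tail_weight_def q_eq[symmetric] by simp
qed

lemma parity_tuples_eq: "parity_tuples k = (\<Union>L. tail_tuples k 1 L)"
  by (auto simp: parity_tuples_def tail_tuples_def)

text \<open>
  The Pochhammer symbols and their reciprocals are bounded, and the exponent of \<open>q\<close> is at least
  \<open>M\<^sub>1 - 1\<close>, where \<open>2 M\<^sub>1\<close> is at least the sum of all \<open>n\<^sub>j\<close>. So a product of geometric series of ratio
  \<open>\<bar>q\<bar>\<^bsup>1/2\<^esup>\<close> dominates the multisum.
\<close>
lemma summable_nahm: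
  assumes k: "k \<ge> 1" and i: "i \<le> k"
  shows "nahm_term k i \<tau> summable_on parity_tuples k"
proof -
  define s where "s = sqrt (norm q)"
  have s: "0 < s" "s < 1" "s\<^sup>2 = norm q"
    using norm_q_less_1 q_nonzero by (auto simp: s_def)
  obtain C1 where C1: "C1 > 0" "\<And>n. norm (1 / qpoch q q n) \<le> C1"
    using inverse_qpoch_bounded[OF norm_q_less_1] by blast
  obtain C2 where C2: "C2 > 0" "\<And>n. norm (qpoch (- q) q n) \<le> C2"
    using qpoch_bounded[OF norm_q_less_1] by blast
  define C where "C = C2 * C1 ^ Suc k / norm q"
  have "Infinite_Set_Sum.abs_summable_on (\<lambda>n. \<Prod>j\<in>{1..k+1}. s ^ n j) ({1..k+1} \<rightarrow>\<^sub>E UNIV)"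
  proof (rule abs_summable_on_prod_PiE)
    have "(\<lambda>m. s ^ m) summable_on UNIV"
      using s by (subst summable_on_UNIV_nonneg_real_iff) (auto intro: summable_geometric)
    then show "Infinite_Set_Sum.abs_summable_on (\<lambda>m. s ^ m) UNIV" 
      unfolding abs_summable_equivalent[symmetric] using s by simp
  qed auto
  then have "(\<lambda>n. \<Prod>j\<in>{1..k+1}. s ^ n j) summable_on ({1..k+1} \<rightarrow>\<^sub>E UNIV)"
    unfolding abs_summable_equivalent[symmetric] by (rule abs_summable_summable)
  then have "(\<lambda>n. \<Prod>j\<in>{1..k+1}. s ^ n j) summable_on parity_tuples k"
    by (rule summable_on_subset_banach) (auto simp: parity_tuples_def)
  then have "(\<lambda>n. C * (\<Prod>j\<in>{1..k+1}. s ^ n j)) summable_on parity_tuples k"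
    by (rule summable_on_cmult_right)
  then show ?thesis
  proof (rule abs_summable_summable [OF Infinite_Sum.abs_summable_on_comparison_test'])
    fix n assume "n \<in> parity_tuples k"
    then obtain L where nL: "n \<in> tail_tuples k 1 L" by (auto simp: parity_tuples_eq)
    then have par: "[n k = n (k + 1)] (mod 2)" and L: "tail_sum k 1 n = L"
      by (auto simp: tail_tuples_def)
    have sumle: "(\<Sum>j=1..k+1. n j) \<le> 2 * L"
    proof -
      have "{1..k+1} = {1..k-1} \<union> {k, k+1}" using k by auto
      then have "(\<Sum>j=1..k+1. n j) = (\<Sum>j=1..k-1. n j) + (n k + n (k + 1))"
        using k by (simp add: sum.union_disjoint)
      moreover have "n k + n (k + 1) = 2 * ((n k + n (k + 1)) div 2)"
        using par unfolding cong_def by presburger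
      ultimately show ?thesis using L unfolding tail_sum_def by linarith
    qed
    have "L \<le> Suc ((L choose 2) + (if i = k then 1 else 0) * L)"
      by (induction L) (simp_all add: numeral_2_eq_2)
    then have "norm q ^ Suc ((L choose 2) + (if i = k then 1 else 0) * L) \<le> norm q ^ L"
      using norm_q_less_1 by (intro power_decreasing) auto
    then have "norm q ^ ((L choose 2) + (if i = k then 1 else 0) * L) \<le> norm q ^ L / norm q"
      using q_nonzero by (simp add: field_simps)
    also have "norm q ^ L = s ^ (2 * L)" by (simp only: power_mult s(3))
    also have "s ^ (2 * L) / norm q \<le> s ^ (\<Sum>j=1..k+1. n j) / norm q"
      using s sumle by (intro divide_right_mono power_decreasing) auto
    finally have 1: "norm q ^ ((L choose 2) + (if i = k then 1 else 0) * L) \<le> (\<Prod>j\<in>{1..k+1}. s ^ n j) / norm q"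
      by (simp only: power_sum)
    have 2: "norm (tail_weight k i 1 n) \<le> C1 ^ Suc k"
    proof -
      let ?x = "(\<Sum>j=Suc 1..k. (real (tail_sum k j n))\<^sup>2 + (if k < i + j then real (tail_sum k j n) else 0))
           + ((real (n k) - real (n (k + 1))) / 2)\<^sup>2"
      have "?x \<ge> 0" by (intro add_nonneg_nonneg sum_nonneg) auto
      then have "norm (Q ?x) \<le> 1" using norm_Q_antimono[of 0 ?x] by simp
      moreover have "norm (\<Prod>j=1..k+1. 1 / qpoch q q (n j)) \<le> (\<Prod>j=1..k+1. C1)"
        unfolding prod_norm[symmetric] using C1 by (intro prod_mono) auto
      ultimately have "norm (Q ?x) * norm (\<Prod>j=1..k+1. 1 / qpoch q q (n j)) \<le> 1 * C1 ^ Suc k"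
        by (intro mult_mono) auto
      moreover have "tail_weight k i 1 n = Q ?x * (\<Prod>j=1..k+1. 1 / qpoch q q (n j))"
        unfolding tail_weight_def by (simp only: prod_dividef) simp
      ultimately show ?thesis by (simp only: norm_mult mult_1)
    qed
    have "norm (nahm_term k i \<tau> n) = norm q ^ ((L choose 2) + (if i = k then 1 else 0) * L)
        * norm (qpoch (- q) q L) * norm (tail_weight k i 1 n)"
      by (simp only: nahm_term_eq[OF k i nL] norm_mult norm_power)
    also have "\<dots> \<le> (\<Prod>j\<in>{1..k+1}. s ^ n j) / norm q * C2 * C1 ^ Suc k"
      using 1 2 C1 C2 s by (intro mult_mono mult_nonneg_nonneg divide_nonneg_nonneg prod_nonneg) auto
    also have "\<dots> = C * (\<Prod>j\<in>{1..k+1}. s ^ n j)" by (simp add: C_def)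
    finally show "norm (nahm_term k i \<tau> n) \<le> C * (\<Prod>j\<in>{1..k+1}. s ^ n j)" .
  qed
qed

section \<open>Evaluation of the multisum\<close>

lemma summable_theta_seq:
  assumes "k \<ge> 1"
  shows "theta_seq k i 1 summable_on UNIV"
  unfolding theta_seq_def using assms by (intro summable_theta) auto

lemma infsum_nahm:
  assumes k: "k \<ge> 1" and i: "i \<le> k"
  shows "(\<Sum>\<^sub>\<infinity>n\<in>parity_tuples k. nahm_term k i \<tau> n)
    = qpoch_inf (- q) q / qpoch_inf q q
        * (\<Sum>\<^sub>\<infinity>r. theta_seq k i 1 r * limit_weight (if i = k then 1 else 0) r)"
proof -
  let ?e = "if i = k then 1 else 0 :: nat"
  let ?u = "\<lambda>L. q ^ ((L choose 2) + ?e * L) * qpoch (- q) q L"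
  obtain T where T: "(nahm_term k i \<tau> has_sum T) (parity_tuples k)"
    using summable_nahm[OF k i] by (auto simp: summable_on_def)
  have "((\<lambda>(L, n). nahm_term k i \<tau> n) has_sum T) (Sigma UNIV (tail_tuples k 1))"
  proof (rule has_sum_reindex_bij_witness[of _ snd "\<lambda>n. (tail_sum k 1 n, n)", THEN iffD1, OF _ _ _ _ _ refl T])
    show "(tail_sum k 1 n, n) \<in> Sigma UNIV (tail_tuples k 1)" if "n \<in> parity_tuples k" for n
      using that by (simp add: parity_tuples_def tail_tuples_def)
    show "(tail_sum k 1 (snd x), snd x) = x" if "x \<in> Sigma UNIV (tail_tuples k 1)" for x
      using that by (auto simp: tail_tuples_def)
    show "snd x \<in> parity_tuples k" if "x \<in> Sigma UNIV (tail_tuples k 1)" for x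
      using that by (auto simp: parity_tuples_eq)
  qed simp_all
  then have "((\<lambda>L. \<Sum>n\<in>tail_tuples k 1 L. nahm_term k i \<tau> n) has_sum T) UNIV"
    by (rule has_sum_SigmaD) (simp add: finite_tail_tuples)
  also have "(\<lambda>L. \<Sum>n\<in>tail_tuples k 1 L. nahm_term k i \<tau> n) = (\<lambda>L. ?u L * bailey_sum ?e (theta_seq k i 1) L)"
  proof
    fix L
    have "(\<Sum>n\<in>tail_tuples k 1 L. nahm_term k i \<tau> n) = (\<Sum>n\<in>tail_tuples k 1 L. ?u L * tail_weight k i 1 n)"
      by (intro sum.cong refl nahm_term_eq[OF k i])
    also have "\<dots> = ?u L * bailey_sum 0 (theta_seq k i 1) L"
      using sum_tail_tuples[OF k k, of i L] by (simp only: sum_distrib_left[symmetric])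
    also have "bailey_sum 0 (theta_seq k i 1) L = bailey_sum ?e (theta_seq k i 1) L"
    proof (cases "i = k")
      case True
      then show ?thesis
        using bailey_sum_change_parameter[OF theta_seq_antisym[of k 1 i]] by simp
    qed simp
    finally show "(\<Sum>n\<in>tail_tuples k 1 L. nahm_term k i \<tau> n) = ?u L * bailey_sum ?e (theta_seq k i 1) L" .
  qed
  finally have "T = qpoch_inf (- q) q / qpoch_inf q q * (\<Sum>\<^sub>\<infinity>r. theta_seq k i 1 r * limit_weight ?e r)"
    using bailey_limit[OF summable_theta_seq[OF k], of ?e i] by (rule has_sum_unique) simp
  with infsumI[OF T] show ?thesis by simp
qed

text \<open>Completing the square splits a term of the theta series into two quadratic exponentials.\<close>
lemma theta_term_eq:
  assumes k: "k \<ge> 1"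
  shows "qpow \<tau> (- ((2 * real i - 1)\<^sup>2 / (8 * (2 * real k + 1)))) * theta_term k i \<tau> r
    = (2 * of_int r + 1) * Q ((real k + 1 / 2) * of_int (r\<^sup>2) + (real i - 1 / 2) * of_int r)
    + (2 * of_int r + 1) * Q ((real k + 1 / 2) * of_int (r\<^sup>2) + (real i + 1 / 2) * of_int r)"
proof -
  let ?a = "- ((2 * real i - 1)\<^sup>2 / (8 * (2 * real k + 1)))"
  let ?b = "(2 * real k + 1) / 2 * (of_int r + (2 * real i - 1) / (4 * real k + 2))\<^sup>2"
  let ?c = "(real k + 1 / 2) * of_int (r\<^sup>2) + (real i - 1 / 2) * of_int r"
  have "?a + ?b = ?c"
  proof -
    define K where "K = 2 * real k + 1"
    define J where "J = 2 * real i - 1"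
    have K: "K \<noteq> 0" by (simp add: K_def)
    have "- (J\<^sup>2 / (8 * K)) + K / 2 * (of_int r + J / (2 * K))\<^sup>2 = K / 2 * (of_int r)\<^sup>2 + J / 2 * of_int r"
      using K by (simp add: field_simps power2_eq_square)
    moreover have KJ: "4 * real k + 2 = 2 * K" "real k + 1 / 2 = K / 2" "real i - 1 / 2 = J / 2"
      by (simp_all add: K_def J_def)
    ultimately show ?thesis by (simp only: KJ K_def[symmetric] J_def[symmetric] of_int_power)
  qed
  then have 1: "Q ?a * Q ?b = Q ?c" by (simp only: Q_add[symmetric])
  have "?c + of_int r = (real k + 1 / 2) * of_int (r\<^sup>2) + (real i + 1 / 2) * of_int r"
    by (simp add: algebra_simps)
  then have 2: "Q ?c * Q (of_int r) = Q ((real k + 1 / 2) * of_int (r\<^sup>2) + (real i + 1 / 2) * of_int r)"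
    by (simp only: Q_add[symmetric])
  have "Q ?a * theta_term k i \<tau> r = (2 * of_int r + 1) * ((Q ?a * Q ?b) * (1 + Q (of_int r)))"
    by (simp only: theta_term_def mult_ac)
  also have "\<dots> = (2 * of_int r + 1) * Q ?c + (2 * of_int r + 1) * (Q ?c * Q (of_int r))"
    unfolding 1 by (simp only: distrib_left mult_1_right)
  finally show ?thesis unfolding 2 .
qed

lemma infsum_theta_odd:
  "(\<Sum>\<^sub>\<infinity>r::int. (2 * of_int r + 1) * Q (a * of_int (r\<^sup>2) + a * of_int r)) = 0"
proof -
  let ?f = "\<lambda>r::int. (2 * of_int r + 1) * Q (a * of_int (r\<^sup>2) + a * of_int r)"
  have "infsum ?f UNIV = infsum (\<lambda>r. ?f (- 1 - r)) UNIV"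
    by (rule infsum_reindex_bij_witness[of _ "\<lambda>r. - 1 - r" "\<lambda>r. - 1 - r"]) auto
  also have "(\<lambda>r. ?f (- 1 - r)) = (\<lambda>r. - ?f r)"
  proof
    fix r :: int
    have "a * of_int ((- 1 - r)\<^sup>2) + a * of_int (- 1 - r) = a * of_int (r\<^sup>2) + a * of_int r"
      by (simp add: power2_eq_square algebra_simps)
    moreover have "2 * of_int (- 1 - r) + 1 = - (2 * of_int r + 1 :: complex)" by simp
    ultimately show "?f (- 1 - r) = - ?f r" by (simp only: mult_minus_left)
  qed
  also have "infsum (\<lambda>r. - ?f r) UNIV = - infsum ?f UNIV" by (rule infsum_uminus)
  finally show ?thesis by simp
qed

lemma theta_seq_limit_weight:
  "theta_seq k i 1 r * Q (of_int (r * (r + s)) / 2) =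
    (2 * of_int r + 1) * Q ((real (k - 1) + 3 / 2) * of_int (r\<^sup>2) + (real (min i (k - 1)) + of_int s / 2) * of_int r)"
proof -
  have "real (Suc (k - 1)) * of_int (r\<^sup>2) + real (min i (k - 1)) * of_int r + of_int (r * (r + s)) / 2
    = (real (k - 1) + 3 / 2) * of_int (r\<^sup>2) + (real (min i (k - 1)) + of_int s / 2) * of_int r"
    by (simp add: power2_eq_square field_simps)
  then show ?thesis
    by (simp only: theta_seq_def mult.assoc Q_add[symmetric])
qed

lemma infsum_theta:
  assumes k: "k \<ge> 1" and i: "i \<le> k"
  defines "A \<equiv> qpow \<tau> (- ((2 * real i - 1)\<^sup>2 / (8 * (2 * real k + 1))))"
  shows "theta_term k i \<tau> summable_on UNIV"
    and "A * (\<Sum>\<^sub>\<infinity>r. theta_term k i \<tau> r)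
      = (\<Sum>\<^sub>\<infinity>r. theta_seq k i 1 r * limit_weight (if i = k then 1 else 0) r)"
proof -
  let ?f = "\<lambda>r::int. (2 * of_int r + 1) * Q ((real k + 1 / 2) * of_int (r\<^sup>2) + (real i - 1 / 2) * of_int r)"
  let ?g = "\<lambda>r::int. (2 * of_int r + 1) * Q ((real k + 1 / 2) * of_int (r\<^sup>2) + (real i + 1 / 2) * of_int r)"
  have f: "?f summable_on UNIV" and g: "?g summable_on UNIV"
    using k i by (intro summable_theta; simp)+
  have eq: "A * theta_term k i \<tau> r = ?f r + ?g r" for r
    unfolding A_def by (rule theta_term_eq[OF k])
  have "(\<lambda>r. A * theta_term k i \<tau> r) summable_on UNIV"
    unfolding eq using f g by (rule summable_on_add)
  then show "theta_term k i \<tau> summable_on UNIV"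
    by (subst (asm) summable_on_cmult_right') (simp_all add: A_def)
  have "A * (\<Sum>\<^sub>\<infinity>r. theta_term k i \<tau> r) = (\<Sum>\<^sub>\<infinity>r. A * theta_term k i \<tau> r)"
    by (rule infsum_cmult_right'[symmetric])
  also have "\<dots> = infsum ?f UNIV + infsum ?g UNIV"
    unfolding eq using f g by (rule infsum_add)
  also have "\<dots> = (\<Sum>\<^sub>\<infinity>r. theta_seq k i 1 r * limit_weight (if i = k then 1 else 0) r)"
  proof (cases "i = k")
    case True
    have "infsum ?g UNIV = 0" unfolding True by (rule infsum_theta_odd)
    moreover have "?f r = theta_seq k i 1 r * limit_weight 1 r" for r
      using theta_seq_limit_weight[of k i r 1] True k
      by (simp add: limit_weight_def of_nat_diff add.commute)
    ultimately show ?thesis using True by simp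
  next
    case False
    then have i': "min i (k - 1) = i" using i by simp
    have "?f r + ?g r = theta_seq k i 1 r * limit_weight 0 r" for r
      using theta_seq_limit_weight[of k i r 1] theta_seq_limit_weight[of k i r "- 1"] k i'
      by (simp add: limit_weight_def of_nat_diff distrib_left add.commute)
    with False show ?thesis using infsum_add[OF f g] by simp
  qed
  finally show "A * (\<Sum>\<^sub>\<infinity>r. theta_term k i \<tau> r)
      = (\<Sum>\<^sub>\<infinity>r. theta_seq k i 1 r * limit_weight (if i = k then 1 else 0) r)" .
qed

end

theorem theorem4p5:
  fixes \<tau> q :: complex and k i :: nat
  assumes "Im \<tau> > 0" and "q = qpow \<tau> 1" and "k \<ge> 1" and "i \<le> k"
  shows "theta_term k i \<tau> summable_on (UNIV :: int set)
    \<and> nahm_term k i \<tau> summable_on parity_tuples k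
    \<and> qpow \<tau> (- ((2 * real i - 1)\<^sup>2 / (8 * (2 * real k + 1))))
        * (qpoch_inf (- q) q / qpoch_inf q q)
        * (\<Sum>\<^sub>\<infinity>n\<in>(UNIV :: int set). theta_term k i \<tau> n)
      = (\<Sum>\<^sub>\<infinity>n\<in>parity_tuples k. nahm_term k i \<tau> n)"
proof -
  interpret nome \<tau> q
    by unfold_locales (use assms in auto)
  show ?thesis
    using infsum_theta[OF assms(3,4)] summable_nahm[OF assms(3,4)] infsum_nahm[OF assms(3,4)]
    by (simp add: mult_ac)
qed

end
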